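(* Let $k$ be a fixed natural number ($k\ge1$). Then for all irreducible polynomials $Q\in\mathbb{F}_q[x]$ of sufficiently large degree, \[ \sum_{\substack{\chi\ (\mathrm{mod}\ Q)\\ \chi\neq\chi_{0}}}\left|L\left(\tfrac{1}{2},\chi\right)\right|^{2k}\gg_{k}|Q|\left(\deg Q\right)^{k^{2}}. \] That is, there are a constant $c>0$ and an integer $d_0$, depending only on $k$ and $q$, such that for every irreducible $Q$ with $\deg Q\ge d_0$ the left-hand side is at least $c\,|Q|(\deg Q)^{k^2}$.
   Context: $\mathbb{F}_q$ is a fixed finite field with $q$ elements and $\mathcal{A}=\mathbb{F}_q[x]$. For nonzero $N\in\mathcal{A}$, $|N|=q^{\deg N}$. A Dirichlet character modulo $Q$ is a function $\chi:\mathcal{A}\to\mathbb{C}$ with $\chi(A+BQ)=\chi(A)$ and $\chi(AB)=\chi(A)\chi(B)$ for all $A,B\in\mathcal{A}$, and $\chi(A)\neq0$ if and only if $(A,Q)=1$; $\chi_0$ is the trivial character ($\chi_0(A)=1$ whenever $(A,Q)=1$). The L-function is $L(s,\chi)=\sum_{N\text{ monic}}\chi(N)|N|^{-s}$ for $\Re(s)>1$. For $\chi\neq\chi_0$ one has $\sum_{N\text{ monic},\,\deg N=n}\chi(N)=0$ for $n\ge\deg Q$, so $L(s,\chi)$ is a polynomial in $q^{-s}$, which gives its value for all $s$; in particular $L(\tfrac12,\chi)=\sum_{n=0}^{\deg Q-1}q^{-n/2}\sum_{N\text{ monic},\,\deg N=n}\chi(N)$. *)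

theory Defs
  imports "HOL-Analysis.Analysis" "HOL-Computational_Algebra.Computational_Algebra"
begin

text \<open>The field \<open>\<F>\<^sub>q\<close> is an arbitrary type \<open>'a\<close> of class \<open>{field, finite}\<close>, so \<open>q = CARD('a)\<close>.\<close>

text \<open>The value at \<open>0\<close> is irrelevant: the norm is only ever applied to nonzero polynomials.\<close>

definition pnorm :: "'a::{field,finite} poly \<Rightarrow> real" where
  "pnorm N = real CARD('a) ^ degree N"

definition monics :: "nat \<Rightarrow> 'a::{field,finite} poly set" where
  "monics n = {N. lead_coeff N = 1 \<and> degree N = n}"

definition dirichlet_character ::
  "'a::{field,finite} poly \<Rightarrow> ('a poly \<Rightarrow> complex) \<Rightarrow> bool" where
  "dirichlet_character Q \<psi> \<longleftrightarrow>
     (\<forall>A B. \<psi> (A + B * Q) = \<psi> A) \<and>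
     (\<forall>A B. \<psi> (A * B) = \<psi> A * \<psi> B) \<and>
     (\<forall>A. \<psi> A \<noteq> 0 \<longleftrightarrow> coprime A Q)"

definition trivial_character :: "'a::{field,finite} poly \<Rightarrow> 'a poly \<Rightarrow> complex" where
  "trivial_character Q A = (if coprime A Q then 1 else 0)"

text \<open>
  The Dirichlet series, with its terms grouped by degree. For \<open>Re s > 1\<close> this is the absolutely
  convergent sum over all monic \<open>N\<close> (lemma \<open>has_sum_dirichlet_L\<close>). For a nontrivial
  character all groups of degree at least \<open>degree Q\<close> vanish, so the sum is a polynomial in
  \<open>q powr (-s)\<close> for every \<open>s\<close>, i.e. the continuation of the series (lemma \<open>dirichlet_L_eq\<close>).
\<close>

definition dirichlet_L :: "('a::{field,finite} poly \<Rightarrow> complex) \<Rightarrow> complex \<Rightarrow> complex" where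
  "dirichlet_L \<psi> s = (\<Sum>n. \<Sum>N\<in>monics n. \<psi> N * complex_of_real (pnorm N) powr (- s))"

lemma coprime_imp_bezout_poly:
  fixes A B :: "'a::field poly"
  assumes "coprime A B"
  shows "\<exists>U V. U * A + V * B = 1"
  using assms
proof (induction "if B = 0 then 0 else Suc (degree B)" arbitrary: A B rule: less_induct)
  case less
  show ?case
  proof (cases "B = 0")
    case True
    then have "A dvd 1" using less.prems by simp
    then show ?thesis using True by (auto simp: dvd_def mult.commute)
  next
    case False
    have "coprime B (A mod B)"
      using less.prems unfolding coprime_def by (meson dvd_mod_iff)
    moreover have "(if A mod B = 0 then 0 else Suc (degree (A mod B))) <
                   (if B = 0 then 0 else Suc (degree B))"
      using False degree_mod_less'[OF False, of A] by auto
    ultimately obtain U V where "U * B + V * (A mod B) = 1"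
      using less.hyps by blast
    also have "U * B + V * (A mod B) = V * A + (U - V * (A div B)) * B"
      by (simp add: algebra_simps flip: minus_div_mult_eq_mod)
    finally show ?thesis by blast
  qed
qed

lemma coprime_dvd_mult_poly:
  fixes A B C :: "'a::field poly"
  assumes "coprime B C" "C dvd B * A"
  shows "C dvd A"
proof -
  obtain U V where UV: "U * B + V * C = 1" using coprime_imp_bezout_poly[OF assms(1)] by blast
  have "A = (U * B + V * C) * A" using UV by simp
  also have "\<dots> = U * (B * A) + C * (V * A)" by (simp add: algebra_simps)
  finally show ?thesis using assms(2) by (metis dvd_add dvd_mult dvd_triv_left)
qed

lemma coprime_mult_poly_iff:
  fixes A B Q :: "'a::field poly"
  shows "coprime (A * B) Q \<longleftrightarrow> coprime A Q \<and> coprime B Q"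
proof
  assume "coprime (A * B) Q"
  then show "coprime A Q \<and> coprime B Q" unfolding coprime_def by auto
next
  assume "coprime A Q \<and> coprime B Q"
  then have AB: "coprime A Q" "coprime B Q" by auto
  show "coprime (A * B) Q"
  proof (rule coprimeI)
    fix D assume D: "D dvd A * B" "D dvd Q"
    then have "coprime A D" using AB(1) by (meson coprime_def dvd_trans)
    then have "D dvd B" using D(1) by (rule coprime_dvd_mult_poly)
    then show "is_unit D" using AB(2) D(2) by (meson coprime_def)
  qed
qed

lemma dirichlet_character_trivial: "dirichlet_character Q (trivial_character Q)"
proof -
  have "coprime (A + B * Q) Q \<longleftrightarrow> coprime A Q" for A B
    unfolding coprime_def by (metis dvd_add_left_iff dvd_mult)
  then show ?thesis
    by (simp add: dirichlet_character_def trivial_character_def coprime_mult_poly_iff)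
qed

lemma dirichlet_character_cong:
  assumes "dirichlet_character Q \<psi>" "Q dvd A - B"
  shows "\<psi> A = \<psi> B"
proof -
  from assms(2) obtain C where "A - B = C * Q" by (metis dvd_def mult.commute)
  then have "A = B + C * Q" by (simp add: algebra_simps)
  then show ?thesis using assms(1) by (simp add: dirichlet_character_def)
qed

lemma dirichlet_character_1:
  assumes "dirichlet_character Q \<psi>"
  shows "\<psi> 1 = 1"
proof -
  have "\<psi> (1 * 1) = \<psi> 1 * \<psi> 1" "\<psi> 1 \<noteq> 0"
    using assms unfolding dirichlet_character_def by (blast, simp)
  then show ?thesis by simp
qed

lemma dirichlet_character_power:
  assumes "dirichlet_character Q \<psi>"
  shows "\<psi> (A ^ n) = \<psi> A ^ n"
  using assms dirichlet_character_1[OF assms]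
  by (induction n) (auto simp: dirichlet_character_def)

lemma monics_eq: "monics n = (\<lambda>xs. Poly xs + monom 1 n) ` {xs :: 'a::{field,finite} list. length xs = n}"
proof (intro equalityI subsetI)
  fix N :: "'a poly" assume "N \<in> monics n"
  then have N: "coeff N n = 1" "degree N = n" by (auto simp: monics_def)
  have "N = Poly (map (coeff N) [0..<n]) + monom 1 n"
    using N by (intro poly_eqI) (auto simp: nth_default_def coeff_eq_0)
  then show "N \<in> (\<lambda>xs. Poly xs + monom 1 n) ` {xs. length xs = n}" by force
next
  fix N :: "'a poly" assume "N \<in> (\<lambda>xs. Poly xs + monom 1 n) ` {xs. length xs = n}"
  then obtain xs where xs: "length xs = n" "N = Poly xs + monom 1 n" by auto
  have c: "coeff N n = 1" using xs by (simp add: nth_default_def)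
  have "degree N \<le> n" using xs by (intro degree_le) (auto simp: nth_default_def)
  moreover have "n \<le> degree N" using c by (intro le_degree) auto
  ultimately show "N \<in> monics n" using c by (simp add: monics_def)
qed

lemma finite_monics: "finite (monics n)"
  unfolding monics_eq using finite_lists_length_eq[of "UNIV :: 'a set" n] by simp

lemma card_monics_le: "card (monics n :: 'a::{field,finite} poly set) \<le> CARD('a) ^ n"
proof -
  have "card (monics n :: 'a poly set) \<le> card {xs :: 'a list. length xs = n}"
    unfolding monics_eq using finite_lists_length_eq[of "UNIV :: 'a set" n]
    by (intro card_image_le) simp
  also have "\<dots> = CARD('a) ^ n"
    using card_lists_length_eq[of "UNIV :: 'a set" n] by simp
  finally show ?thesis .
qed

lemma finite_residues:
  assumes "(Q :: 'a::{field,finite} poly) \<noteq> 0"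
  shows "finite (range (\<lambda>A. A mod Q))"
proof (rule finite_subset)
  show "range (\<lambda>A. A mod Q) \<subseteq> insert 0 {p. degree p < degree Q}"
    using assms by (auto dest: degree_mod_less')
  have "{p :: 'a poly. degree p < degree Q} \<subseteq> Poly ` {xs. length xs = degree Q}"
  proof
    fix p :: "'a poly" assume "p \<in> {p. degree p < degree Q}"
    then have "p = Poly (map (coeff p) [0..<degree Q])"
      by (intro poly_eqI) (auto simp: nth_default_def coeff_eq_0)
    then show "p \<in> Poly ` {xs. length xs = degree Q}" by force
  qed
  then show "finite (insert 0 {p :: 'a poly. degree p < degree Q})"
    using finite_lists_length_eq[of "UNIV :: 'a set" "degree Q"] finite_surj by auto
qed

lemma dirichlet_character_root_of_unity:
  fixes Q :: "'a::{field,finite} poly"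
  assumes "dirichlet_character Q \<psi>" "Q \<noteq> 0" "coprime A Q"
  shows "\<exists>n\<in>{1..card (range (\<lambda>A. A mod Q))}. \<psi> A ^ n = 1"
proof -
  let ?R = "range (\<lambda>A. A mod Q)"
  let ?f = "\<lambda>i. A ^ i mod Q"
  have "\<not> inj_on ?f {0..card ?R}"
  proof
    assume "inj_on ?f {0..card ?R}"
    then have "card {0..card ?R} \<le> card ?R"
      by (rule card_inj_on_le) (auto simp: finite_residues[OF assms(2)])
    then show False by simp
  qed
  then obtain i j where ij: "i < j" "j \<le> card ?R" "A ^ i mod Q = A ^ j mod Q"
    unfolding inj_on_def by (metis atLeastAtMost_iff linorder_neqE_nat)
  then have "\<psi> A ^ i = \<psi> A ^ j"
    using dirichlet_character_cong[OF assms(1), of "A ^ i" "A ^ j"]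
    by (simp add: dirichlet_character_power[OF assms(1)] mod_eq_dvd_iff)
  also have "\<dots> = \<psi> A ^ i * \<psi> A ^ (j - i)"
    using ij by (simp flip: power_add)
  finally have "\<psi> A ^ (j - i) = 1"
    using assms by (auto simp: dirichlet_character_def)
  then show ?thesis using ij by (intro bexI[of _ "j - i"]) auto
qed

lemma norm_dirichlet_character_le_1:
  assumes "dirichlet_character Q \<psi>" "Q \<noteq> 0"
  shows "norm (\<psi> A) \<le> 1"
proof (cases "coprime A Q")
  case True
  then obtain n where n: "n \<ge> 1" "\<psi> A ^ n = 1"
    using dirichlet_character_root_of_unity[OF assms True] by auto
  then have "norm (\<psi> A) ^ n = 1" by (metis norm_one norm_power)
  then have "norm (\<psi> A) = 1" using n by (intro power_eq_imp_eq_base[of _ n 1]) auto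
  then show ?thesis by simp
next
  case False
  then have "\<psi> A = 0" using assms by (auto simp: dirichlet_character_def)
  then show ?thesis by simp
qed

lemma finite_dirichlet_characters:
  fixes Q :: "'a::{field,finite} poly"
  assumes "Q \<noteq> 0"
  shows "finite {\<psi>. dirichlet_character Q \<psi>}"
proof (rule inj_on_finite)
  let ?R = "range (\<lambda>A. A mod Q)"
  let ?Z = "insert 0 (\<Union>n\<in>{1..card ?R}. {z::complex. z ^ n = 1})"
  let ?r = "\<lambda>\<psi>::'a poly \<Rightarrow> complex. restrict \<psi> ?R"
  show "inj_on ?r {\<psi>. dirichlet_character Q \<psi>}"
  proof (intro inj_onI ext, clarsimp)
    fix \<psi> \<phi> A
    assume *: "dirichlet_character Q \<psi>" "dirichlet_character Q \<phi>" "?r \<psi> = ?r \<phi>"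
    have "\<psi> A = \<psi> (A mod Q)" "\<phi> A = \<phi> (A mod Q)"
      by (rule dirichlet_character_cong[OF *(1)] dirichlet_character_cong[OF *(2)],
          simp add: minus_mod_eq_mult_div)+
    moreover have "\<psi> (A mod Q) = \<phi> (A mod Q)"
      using fun_cong[OF *(3), of "A mod Q"] by simp
    ultimately show "\<psi> A = \<phi> A" by simp
  qed
  show "?r ` {\<psi>. dirichlet_character Q \<psi>} \<subseteq> ?R \<rightarrow>\<^sub>E ?Z"
  proof clarify
    fix \<psi> assume chi: "dirichlet_character Q \<psi>"
    have "\<psi> A \<in> ?Z" for A
    proof (cases "coprime A Q")
      case True
      then show ?thesis using dirichlet_character_root_of_unity[OF chi assms] by simp
    next
      case False
      then show ?thesis using chi by (auto simp: dirichlet_character_def)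
    qed
    then show "?r \<psi> \<in> ?R \<rightarrow>\<^sub>E ?Z" by (auto intro: restrict_PiE)
  qed
  show "finite (?R \<rightarrow>\<^sub>E ?Z)"
    by (intro finite_PiE finite_residues[OF assms]) (auto intro!: finite_roots_unity)
qed

lemma sum_monics_eq_0:
  fixes Q :: "'a::{field,finite} poly"
  assumes chi: "dirichlet_character Q \<psi>" "\<psi> \<noteq> trivial_character Q"
    and Q: "Q \<noteq> 0" and n: "degree Q \<le> n"
  shows "(\<Sum>N\<in>monics n. \<psi> N) = 0"
proof -
  from chi(2) obtain B where "\<psi> B \<noteq> trivial_character Q B" by blast
  then have B: "coprime B Q" "\<psi> B \<noteq> 1"
    using chi(1) by (auto simp: trivial_character_def dirichlet_character_def split: if_splits)
  define f where "f N = N + (B * N - N) mod Q" for N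
  have f_cong: "Q dvd f N - B * N" for N
  proof -
    have "f N - B * N = - ((B * N - N) - (B * N - N) mod Q)" by (simp add: f_def)
    then show ?thesis by (simp add: minus_mod_eq_mult_div)
  qed
  have f_monics: "f N \<in> monics n" if "N \<in> monics n" for N
  proof (cases "(B * N - N) mod Q = 0")
    case True
    then show ?thesis using that by (simp add: f_def)
  next
    case False
    then have "degree ((B * N - N) mod Q) < degree N"
      using degree_mod_less'[OF Q False] n that by (simp add: monics_def)
    then show ?thesis using that
      by (auto simp: f_def monics_def degree_add_eq_left coeff_eq_0)
  qed
  have inj: "inj_on f (monics n)"
  proof (rule inj_onI)
    fix M N assume MN: "f M = f N"
    have "Q dvd (f N - B * N) - (f M - B * M)" using f_cong by (rule dvd_diff[OF f_cong])
    then have "Q dvd B * (M - N)" using MN by (simp add: algebra_simps)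
    then have dvd: "Q dvd M - N"
      using B(1) coprime_dvd_mult_poly by blast
    have "(B * M - M) - (B * N - N) = (B - 1) * (M - N)" by (simp add: algebra_simps)
    then have "(B * M - M) mod Q = (B * N - N) mod Q"
      using dvd by (simp add: mod_eq_dvd_iff)
    then show "M = N" using MN by (simp add: f_def)
  qed
  have img: "f ` monics n = monics n"
    using f_monics by (intro endo_inj_surj finite_monics inj) auto
  have "(\<Sum>N\<in>monics n. \<psi> N) = (\<Sum>N\<in>monics n. \<psi> (f N))"
    using sum.reindex[OF inj, of \<psi>] img by simp
  also have "\<dots> = (\<Sum>N\<in>monics n. \<psi> B * \<psi> N)"
    using dirichlet_character_cong[OF chi(1) f_cong] chi(1)
    by (simp add: dirichlet_character_def)
  also have "\<dots> = \<psi> B * (\<Sum>N\<in>monics n. \<psi> N)" by (simp add: sum_distrib_left)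
  finally show ?thesis using B(2) by simp
qed

lemma dirichlet_L_eq:
  fixes Q :: "'a::{field,finite} poly"
  assumes "dirichlet_character Q \<psi>" "\<psi> \<noteq> trivial_character Q" "Q \<noteq> 0"
  shows "dirichlet_L \<psi> s =
    (\<Sum>n<degree Q. (of_nat CARD('a) powr (- s)) ^ n * (\<Sum>N\<in>monics n. \<psi> N))"
proof -
  have q: "of_nat (CARD('a) ^ n) powr (- s) = (of_nat CARD('a) powr (- s) :: complex) ^ n" for n
    by (induction n) (auto simp: powr_times_real)
  have eq: "(\<Sum>N\<in>monics n. \<psi> N * complex_of_real (pnorm N) powr (- s)) =
      (of_nat CARD('a) powr (- s)) ^ n * (\<Sum>N\<in>monics n. \<psi> N)" for n
    using q[of n] by (auto simp: pnorm_def monics_def sum_distrib_left intro!: sum.cong)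
  show ?thesis
    unfolding dirichlet_L_def eq
    by (rule suminf_finite) (auto simp: sum_monics_eq_0[OF assms])
qed

lemma has_sum_dirichlet_L:
  fixes Q :: "'a::{field,finite} poly"
  assumes chi: "dirichlet_character Q \<psi>" "Q \<noteq> 0" and s: "Re s > 1"
  shows "((\<lambda>N. \<psi> N * complex_of_real (pnorm N) powr (- s)) has_sum dirichlet_L \<psi> s)
           {N. lead_coeff N = 1}"
proof -
  let ?g = "\<lambda>N. \<psi> N * complex_of_real (pnorm N) powr (- s)"
  let ?q = "real CARD('a)"
  have "card {0, 1 :: 'a} \<le> CARD('a)" by (rule card_mono) auto
  then have q: "?q > 1" by simp
  define r where "r = ?q powr (1 - Re s)"
  have r: "0 < r" "r < 1" using q s by (auto simp: r_def powr_less_one)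
  have g_le: "norm (?g N) \<le> (?q powr (- Re s)) ^ n" if "N \<in> monics n" for N n
  proof -
    have "norm (?g N) = norm (\<psi> N) * pnorm N powr (- Re s)"
      using q by (simp add: norm_mult norm_powr_real_powr pnorm_def)
    also have "\<dots> \<le> 1 * pnorm N powr (- Re s)"
      by (intro mult_right_mono norm_dirichlet_character_le_1[OF chi]) auto
    also have "pnorm N powr (- Re s) = (?q powr (- Re s)) ^ n"
      using that q by (simp add: pnorm_def monics_def powr_powr mult.commute flip: powr_realpow)
    finally show ?thesis by simp
  qed
  have sum_le: "(\<Sum>N\<in>monics n. norm (?g N)) \<le> r ^ n" for n
  proof -
    have "(\<Sum>N\<in>monics n. norm (?g N)) \<le> real (card (monics n :: 'a poly set)) * (?q powr (- Re s)) ^ n"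
      using g_le by (rule sum_bounded_above)
    also have "\<dots> \<le> ?q ^ n * (?q powr (- Re s)) ^ n"
      using card_monics_le[where 'a = 'a and n = n]
      by (intro mult_right_mono) (auto simp flip: of_nat_power)
    also have "\<dots> = r ^ n"
      using q by (simp add: r_def powr_diff powr_minus field_simps flip: power_mult_distrib)
    finally show ?thesis .
  qed
  have geom: "summable (\<lambda>n. r ^ n)" using r by (intro summable_geometric) auto
  let ?S = "Sigma UNIV monics :: (nat \<times> 'a poly) set"
  have abs: "(\<lambda>x. norm (case x of (n, N) \<Rightarrow> ?g N)) summable_on ?S"
  proof (subst Infinite_Sum.abs_summable_on_Sigma_iff, intro conjI ballI)
    fix n :: nat
    show "(\<lambda>N. norm (case (n, N) of (n, N) \<Rightarrow> ?g N)) summable_on monics n"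
      by (rule summable_on_finite) (rule finite_monics)
  next
    have "summable (\<lambda>n. norm (\<Sum>N\<in>monics n. norm (?g N)))"
      by (rule summable_comparison_test'[OF geom, of 0]) (use sum_le in \<open>simp add: sum_nonneg\<close>)
    then have "(\<lambda>n. \<Sum>N\<in>monics n. norm (?g N)) summable_on UNIV"
      by (rule norm_summable_imp_summable_on)
    moreover have "(\<lambda>n. norm (\<Sum>N\<in>monics n. norm (?g N))) = (\<lambda>n. \<Sum>N\<in>monics n. norm (?g N))"
      by (auto simp: sum_nonneg)
    ultimately show "(\<lambda>n. norm (infsum (\<lambda>N. norm (case (n, N) of (n, N) \<Rightarrow> ?g N)) (monics n))) summable_on UNIV"
      by (simp add: finite_monics)
  qed
  then have summ: "(\<lambda>(n, N). ?g N) summable_on ?S" by (rule Infinite_Sum.abs_summable_summable)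
  then obtain l where l: "((\<lambda>(n, N). ?g N) has_sum l) ?S" by (auto simp: summable_on_def)
  have "((\<lambda>n. \<Sum>N\<in>monics n. ?g N) has_sum l) UNIV"
    by (rule has_sum_SigmaD[OF l]) (auto intro: has_sum_finiteI simp: finite_monics)
  then have L: "l = dirichlet_L \<psi> s"
    unfolding dirichlet_L_def by (intro sums_unique has_sum_imp_sums)
  have "((\<lambda>(n, N). ?g N) has_sum l) ?S \<longleftrightarrow> (?g has_sum l) {N. lead_coeff N = 1}"
    by (rule has_sum_reindex_bij_witness[of _ "\<lambda>N. (degree N, N)" snd]) (auto simp: monics_def)
  then show ?thesis using l L by simp
qed

end

theory Submission
  imports Defs "HOL-Algebra.Multiplicative_Group" "HOL-Real_Asymp.Real_Asymp"
begin

text \<open>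
  The method of Rudnick and Soundararajan. Let \<open>A \<psi>\<close> be the sum of \<open>\<psi> N / sqrt |N|\<close> over monic \<open>N\<close>
  of degree at most \<open>n = deg Q div 4k\<close>, and let \<open>S\<close> be the sum of \<open>|A \<psi>| ^ 2k\<close> over all characters.
  As the sum of \<open>\<psi> M * cnj (\<psi> N)\<close> over all \<open>\<psi>\<close> is never negative, dropping terms with nonnegative
  coefficients gives \<open>S \<le> Re (\<Sum>\<psi>. L \<psi> * A \<psi> ^ (k-1) * cnj (A \<psi>) ^ k)\<close>, where \<open>L \<psi>\<close> is
  the truncated Dirichlet series, equal to \<open>L(1/2, \<psi>)\<close> for nontrivial \<open>\<psi>\<close>; the trivial character
  contributes \<open>o(|Q|)\<close> to the right side. Pointwise,
  \<open>|L| * |A| ^ (2k-1) \<le> |A| ^ 2k / 4 + 4 ^ (2k-1) * |L| ^ 2k\<close>, so the moment is \<open>\<gg> S\<close>.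

  The diagonal terms bound \<open>S\<close> below by the number of characters, which is at least \<open>|Q| - 1\<close>
  since the unit group modulo \<open>Q\<close> is cyclic, times the sum of \<open>d\<^sub>k(N)\<^sup>2 / |N|\<close> over
  \<open>deg N \<le> n\<close>. Put \<open>m = k\<^sup>2\<close>. Then \<open>d\<^sub>m = d\<^sub>k\<^sup>2\<close> on squarefree polynomials, and writing
  \<open>N = S * T\<^sup>2\<close> with \<open>S\<close> squarefree shows that this sum is at least a constant times the sum of
  \<open>d\<^sub>m(N) / |N|\<close>, which is at least \<open>(n div m + 1) ^ m\<close>.
\<close>

section \<open>Convolution and divisor functions on monic polynomials\<close>

definition monics_upto :: "nat \<Rightarrow> 'a::{field,finite} poly set" where
  "monics_upto n = {N. lead_coeff N = 1 \<and> degree N \<le> n}"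

lemma monics_upto_eq: "monics_upto n = (\<Union>i\<le>n. monics i)"
  by (auto simp: monics_upto_def monics_def)

lemma finite_monics_upto [simp]: "finite (monics_upto n)"
  by (simp add: monics_upto_eq finite_monics)

section \<open>Arithmetic of monic polynomials\<close>

lemma monic_nonzero: "lead_coeff N = 1 \<Longrightarrow> N \<noteq> (0 :: 'a::field poly)"
  by auto

lemma monic_mult_left:
  fixes A B :: "'a::field poly"
  assumes "lead_coeff (A * B) = 1" "lead_coeff A = 1"
  shows "lead_coeff B = 1"
  using assms by (simp add: lead_coeff_mult)

lemma monic_mult:
  fixes A B :: "'a::field poly"
  shows "lead_coeff A = 1 \<Longrightarrow> lead_coeff B = 1 \<Longrightarrow> lead_coeff (A * B) = 1"
  by (simp add: lead_coeff_mult)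

lemma ex_monic_associate:
  fixes A :: "'a::field poly"
  assumes "A \<noteq> 0"
  shows "\<exists>B u. lead_coeff B = 1 \<and> u \<noteq> 0 \<and> A = Polynomial.smult u B"
  using assms by (intro exI[of _ "Polynomial.smult (inverse (lead_coeff A)) A"] exI[of _ "lead_coeff A"]) simp

lemma monic_dvd_antisym:
  fixes A B :: "'a::field poly"
  assumes "lead_coeff A = 1" "lead_coeff B = 1" "A dvd B" "B dvd A"
  shows "A = B"
proof -
  obtain C where C: "B = A * C" using assms(3) by (auto simp: dvd_def)
  have "lead_coeff C = 1" using monic_mult_left assms C by metis
  moreover have "degree B \<le> degree A" using assms dvd_imp_degree_le monic_nonzero by metis
  moreover have "degree B = degree A + degree C"
    using C assms monic_nonzero degree_mult_eq by (metis mult_eq_0_iff)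
  ultimately have "degree C = 0" "lead_coeff C = 1" by auto
  then have "C = 1" by (auto elim!: degree_eq_zeroE)
  then show ?thesis using C by simp
qed

lemma monic_mult_eq_1_iff:
  fixes A B :: "'a::field poly"
  assumes "lead_coeff A = 1" "lead_coeff B = 1"
  shows "A * B = 1 \<longleftrightarrow> A = 1 \<and> B = 1"
proof
  assume "A * B = 1"
  then have "A dvd 1" "B dvd 1" by (metis dvd_triv_left, metis dvd_triv_right)
  then show "A = 1 \<and> B = 1" using assms by (auto intro!: monic_dvd_antisym)
qed simp

lemma degree_mult_monic:
  fixes A B :: "'a::field poly"
  assumes "lead_coeff A = 1" "lead_coeff B = 1"
  shows "degree (A * B) = degree A + degree B"
  using assms by (intro degree_mult_eq) auto

lemma pnorm_mult:
  assumes "lead_coeff A = 1" "lead_coeff B = 1"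
  shows "pnorm (A * B) = pnorm A * pnorm B"
  using degree_mult_monic[OF assms] by (simp add: pnorm_def power_add)

section \<open>Ordered factorisations into two monic factors, and Dirichlet convolution\<close>

definition factor_pairs :: "'a::{field,finite} poly \<Rightarrow> ('a poly \<times> 'a poly) set" where
  "factor_pairs N = {(A, B). lead_coeff A = 1 \<and> lead_coeff B = 1 \<and> A * B = N}"

lemma factor_pairs_dvd: "(A, B) \<in> factor_pairs N \<Longrightarrow> A dvd N \<and> B dvd N"
  by (auto simp: factor_pairs_def)

lemma factor_pairs_subset: "factor_pairs N \<subseteq> monics_upto (degree N) \<times> monics_upto (degree N)"
  by (auto simp: factor_pairs_def monics_upto_def degree_mult_monic)

lemma finite_factor_pairs [simp]: "finite (factor_pairs N)"
  by (rule finite_subset[OF factor_pairs_subset]) simp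

text \<open>As \<open>factor_pairs N\<close> is empty unless \<open>N\<close> is monic, this is
  Dirichlet convolution on the monoid of monic polynomials, extended by 0.\<close>

definition dconv :: "('a::{field,finite} poly \<Rightarrow> real) \<Rightarrow> ('a poly \<Rightarrow> real) \<Rightarrow> 'a poly \<Rightarrow> real" where
  "dconv a b N = (\<Sum>(A, B)\<in>factor_pairs N. a A * b B)"

lemma dconv_nonneg:
  assumes "\<And>N. 0 \<le> a N" "\<And>N. 0 \<le> b N"
  shows "0 \<le> dconv a b N"
  unfolding dconv_def using assms by (intro sum_nonneg) auto

lemma dconv_mono:
  assumes "\<And>N. 0 \<le> a N" "\<And>N. a N \<le> a' N" "\<And>N. 0 \<le> b N" "\<And>N. b N \<le> b' N"
  shows "dconv a b N \<le> dconv a' b' N"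
  unfolding dconv_def
proof (rule sum_mono, clarify)
  fix A B
  have "0 \<le> a' A" using assms(1,2) order_trans by blast
  then show "a A * b B \<le> a' A * b' B" using assms by (intro mult_mono) auto
qed

text \<open>Both sides run over the ordered triples of monic polynomials with product
  \<open>N\<close>; the two bracketings are matched by an explicit bijection.\<close>

lemma dconv_assoc: "dconv (dconv a b) c N = dconv a (dconv b c) N"
proof -
  let ?S = "SIGMA p:factor_pairs N. factor_pairs (fst p)"
  let ?T = "SIGMA p:factor_pairs N. factor_pairs (snd p)"
  have "dconv (dconv a b) c N = (\<Sum>x\<in>?S. a (fst (snd x)) * b (snd (snd x)) * c (snd (fst x)))"
    by (simp add: dconv_def case_prod_beta sum_distrib_right sum.Sigma)
  also have "\<dots> = (\<Sum>x\<in>?T. a (fst (fst x)) * (b (fst (snd x)) * c (snd (snd x))))"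
    by (rule sum.reindex_bij_witness[of _ "\<lambda>((A, _), (B, C)). ((A * B, C), (A, B))"
          "\<lambda>((_, C), (A, B)). ((A, B * C), (B, C))"])
       (auto simp: factor_pairs_def mult.assoc lead_coeff_mult)
  also have "\<dots> = dconv a (dconv b c) N"
    by (simp add: dconv_def case_prod_beta sum_distrib_left sum.Sigma)
  finally show ?thesis .
qed

text \<open>Multiply out and group the pairs \<open>(A, B)\<close> by their product. The vanishing
  of \<open>a\<close> and \<open>b\<close> beyond the cut-offs is what makes the full convolution
  appear.\<close>

lemma sum_mult_dconv:
  fixes f :: "'a::{field,finite} poly \<Rightarrow> 'b::real_field"
  assumes f: "\<And>A B. lead_coeff A = 1 \<Longrightarrow> lead_coeff B = 1 \<Longrightarrow> f (A * B) = f A * f B"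
    and a: "\<And>N. degree N > m \<Longrightarrow> a N = 0" and b: "\<And>N. degree N > n \<Longrightarrow> b N = 0"
  shows "(\<Sum>N\<in>monics_upto m. of_real (a N) * f N) * (\<Sum>N\<in>monics_upto n. of_real (b N) * f N) =
         (\<Sum>N\<in>monics_upto (m + n). of_real (dconv a b N) * f N)"
proof -
  let ?P = "monics_upto m \<times> monics_upto n :: ('a poly \<times> 'a poly) set"
  let ?h = "\<lambda>(A, B). of_real (a A * b B) * f (A * B)"
  have sub: "(\<lambda>(A, B). A * B) ` ?P \<subseteq> monics_upto (m + n)"
    by (auto simp: monics_upto_def degree_mult_monic coeff_mult_degree_sum)
  have "(\<Sum>N\<in>monics_upto m. of_real (a N) * f N) * (\<Sum>N\<in>monics_upto n. of_real (b N) * f N) =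
        (\<Sum>p\<in>?P. ?h p)"
    by (simp add: sum_product sum.cartesian_product)
       (auto simp: f monics_upto_def intro!: sum.cong)
  also have "\<dots> = (\<Sum>N\<in>monics_upto (m + n). \<Sum>p\<in>{p\<in>?P. (\<lambda>(A, B). A * B) p = N}. ?h p)"
    by (rule sum.group[symmetric]) (use sub in auto)
  also have "\<dots> = (\<Sum>N\<in>monics_upto (m + n). of_real (dconv a b N) * f N)"
  proof (rule sum.cong, simp)
    fix N :: "'a poly" assume N: "N \<in> monics_upto (m + n)"
    \<comment> \<open>Factor pairs of \<open>N\<close> outside the box \<open>?P\<close> have weight
      0, so summing over the box or over all of \<open>factor_pairs N\<close> is the same.\<close>
    have "degree A \<le> m" if "a A \<noteq> 0" for A using a that not_le by blast
    moreover have "degree B \<le> n" if "b B \<noteq> 0" for B using b that not_le by blast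
    ultimately have "(\<Sum>p\<in>{p\<in>?P. (\<lambda>(A, B). A * B) p = N}. ?h p) = (\<Sum>p\<in>factor_pairs N. ?h p)"
      by (intro sum.mono_neutral_left finite_factor_pairs) (auto simp: factor_pairs_def monics_upto_def)
    also have "\<dots> = of_real (dconv a b N) * f N"
      unfolding dconv_def by (auto simp: sum_distrib_right factor_pairs_def intro!: sum.cong)
    finally show "(\<Sum>p\<in>{p\<in>?P. (\<lambda>(A, B). A * B) p = N}. ?h p) = of_real (dconv a b N) * f N" .
  qed
  finally show ?thesis .
qed

section \<open>Convolution powers\<close>

primrec dconv_power :: "('a::{field,finite} poly \<Rightarrow> real) \<Rightarrow> nat \<Rightarrow> 'a poly \<Rightarrow> real" where
  "dconv_power a 0 N = of_bool (N = 1)"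
| "dconv_power a (Suc k) N = dconv a (dconv_power a k) N"

lemma dconv_power_nonneg: "(\<And>N. 0 \<le> a N) \<Longrightarrow> 0 \<le> dconv_power a k N"
  by (induction k arbitrary: N) (auto intro!: dconv_nonneg)

lemma dconv_power_mono:
  assumes "\<And>N. 0 \<le> a N" "\<And>N. a N \<le> b N"
  shows "dconv_power a k N \<le> dconv_power b k N"
  by (induction k arbitrary: N) (auto intro!: dconv_mono dconv_power_nonneg assms)

text \<open>Only monic divisors of \<open>N\<close> enter the recursion, and their degrees do not
  exceed that of \<open>N\<close>.\<close>

lemma dconv_power_cong:
  assumes "\<And>M. lead_coeff M = 1 \<Longrightarrow> degree M \<le> degree N \<Longrightarrow> a M = b M"
  shows "dconv_power a k N = dconv_power b k N"
  using assms
proof (induction k arbitrary: N)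
  case (Suc k)
  have "a A * dconv_power a k B = b A * dconv_power b k B" if "(A, B) \<in> factor_pairs N" for A B
  proof -
    have *: "lead_coeff A = 1" "lead_coeff B = 1" "degree A \<le> degree N" "degree B \<le> degree N"
      using that factor_pairs_subset[of N] by (auto simp: monics_upto_def)
    have "a A = b A" using Suc.prems * by blast
    moreover have "dconv_power a k B = dconv_power b k B" using Suc.prems * by (intro Suc.IH) auto
    ultimately show ?thesis by simp
  qed
  then show ?case by (auto simp: dconv_def intro!: sum.cong)
qed simp

lemma dconv_unit_left:
  fixes N :: "'a::{field,finite} poly"
  assumes "lead_coeff N = 1"
  shows "dconv (\<lambda>N. of_bool (N = 1)) b N = b N"
proof -
  have "dconv (\<lambda>N. of_bool (N = 1)) b N = (\<Sum>(A, B)\<in>{(1 :: 'a poly, N)}. of_bool (A = 1) * b B)"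
    unfolding dconv_def using assms
    by (intro sum.mono_neutral_right finite_factor_pairs) (auto simp: factor_pairs_def)
  then show ?thesis by simp
qed

lemma dconv_cong:
  assumes "\<And>A B. (A, B) \<in> factor_pairs N \<Longrightarrow> a A = a' A \<and> b B = b' B"
  shows "dconv a b N = dconv a' b' N"
  unfolding dconv_def using assms by (intro sum.cong) auto

lemma dconv_power_add:
  assumes "lead_coeff N = 1"
  shows "dconv_power a (i + j) N = dconv (dconv_power a i) (dconv_power a j) N"
  using assms
proof (induction i arbitrary: N)
  case 0
  have "dconv_power a 0 = (\<lambda>N. of_bool (N = 1))" by auto
  then show ?case using dconv_unit_left[OF 0] by simp
next
  case (Suc i)
  have "dconv_power a (Suc i + j) N = dconv a (dconv (dconv_power a i) (dconv_power a j)) N"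
    using Suc.IH by (auto simp: factor_pairs_def intro!: dconv_cong)
  also have "\<dots> = dconv (dconv_power a (Suc i)) (dconv_power a j) N"
    unfolding dconv_assoc[symmetric] by (auto intro!: dconv_cong)
  finally show ?case .
qed

text \<open>The cut-off for truncated sums: on monic \<open>N\<close>,
  \<open>dconv_power (deg_ind n) k N\<close> counts the ordered factorisations of \<open>N\<close>
  into \<open>k\<close> monic factors of degree at most \<open>n\<close>. These are the coefficients
  of the \<open>k\<close>-th power of a sum over \<open>monics_upto n\<close>.\<close>

definition deg_ind :: "nat \<Rightarrow> 'a::{field,finite} poly \<Rightarrow> real" where
  "deg_ind n N = of_bool (degree N \<le> n)"

lemma dconv_power_deg_ind_eq_0:
  assumes "degree N > k * n"
  shows "dconv_power (deg_ind n) k N = 0"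
  using assms
proof (induction k arbitrary: N)
  case (Suc k)
  have "deg_ind n A * dconv_power (deg_ind n) k B = 0" if "(A, B) \<in> factor_pairs N" for A B
  proof (cases "degree A \<le> n")
    case True
    then have "degree B > k * n" using that Suc.prems
      by (auto simp: factor_pairs_def degree_mult_monic)
    then show ?thesis using Suc.IH by simp
  qed (simp add: deg_ind_def)
  then show ?case by (auto simp: dconv_def intro!: sum.neutral)
qed auto

lemma sum_deg_ind: "(\<Sum>N\<in>monics_upto n. f N) = (\<Sum>N\<in>monics_upto n. of_real (deg_ind n N) * (f N :: 'b::real_field))"
  by (intro sum.cong) (auto simp: deg_ind_def monics_upto_def)

lemma power_sum_monics:
  fixes f :: "'a::{field,finite} poly \<Rightarrow> 'b::real_field"
  assumes f: "\<And>A B. lead_coeff A = 1 \<Longrightarrow> lead_coeff B = 1 \<Longrightarrow> f (A * B) = f A * f B" and "f 1 = 1"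
  shows "(\<Sum>N\<in>monics_upto n. f N) ^ k = (\<Sum>N\<in>monics_upto (k * n). of_real (dconv_power (deg_ind n) k N) * f N)"
proof (induction k)
  case 0
  have "monics_upto 0 = {1 :: 'a poly}"
    by (auto simp: monics_upto_def elim!: degree_eq_zeroE)
  then show ?case using assms(2) by simp
next
  case (Suc k)
  have "(\<Sum>N\<in>monics_upto n. f N) ^ Suc k =
     (\<Sum>N\<in>monics_upto n. of_real (deg_ind n N) * f N) * (\<Sum>N\<in>monics_upto (k * n). of_real (dconv_power (deg_ind n) k N) * f N)"
    unfolding power_Suc Suc.IH by (subst sum_deg_ind) simp
  also have "\<dots> = (\<Sum>N\<in>monics_upto (n + k * n). of_real (dconv (deg_ind n) (dconv_power (deg_ind n) k) N) * f N)"
    by (rule sum_mult_dconv[OF f]) (auto simp: deg_ind_def dconv_power_deg_ind_eq_0)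
  finally show ?case by simp
qed

text \<open>The \<open>k\<close>-fold divisor function \<open>d\<^sub>k\<close>.\<close>

definition ndiv :: "nat \<Rightarrow> 'a::{field,finite} poly \<Rightarrow> real" where
  "ndiv k N = dconv_power (\<lambda>_. 1) k N"

lemma ndiv_nonneg [simp]: "0 \<le> ndiv k N"
  by (simp add: ndiv_def dconv_power_nonneg)

lemma dconv_power_deg_ind_le: "dconv_power (deg_ind n) k N \<le> ndiv k N"
  unfolding ndiv_def by (intro dconv_power_mono) (auto simp: deg_ind_def)

lemma dconv_power_deg_ind_eq: "degree N \<le> n \<Longrightarrow> dconv_power (deg_ind n) k N = ndiv k N"
  unfolding ndiv_def by (intro dconv_power_cong) (auto simp: deg_ind_def)

lemma ndiv_Suc: "ndiv (Suc k) N = (\<Sum>(A, B)\<in>factor_pairs N. ndiv k B)"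
  by (simp add: ndiv_def dconv_def)

lemma ndiv_add: "lead_coeff N = 1 \<Longrightarrow> ndiv (i + j) N = (\<Sum>(A, B)\<in>factor_pairs N. ndiv i A * ndiv j B)"
  by (simp add: ndiv_def dconv_power_add dconv_def)

section \<open>Behaviour of the divisor functions under products\<close>

lemma factor_pairs_refine:
  fixes A B E F :: "'a::field poly"
  assumes nz: "A * B \<noteq> 0" and eq: "E * F = A * B"
    and monic: "lead_coeff A = 1" "lead_coeff B = 1" "lead_coeff E = 1" "lead_coeff F = 1"
  shows "\<exists>A1 A2 B1 B2. lead_coeff A1 = 1 \<and> lead_coeff A2 = 1 \<and> lead_coeff B1 = 1 \<and> lead_coeff B2 = 1 \<and>
      A = A1 * A2 \<and> B = B1 * B2 \<and> E = A1 * B1 \<and> F = A2 * B2"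
proof -
  \<comment> \<open>A monic common divisor \<open>G\<close> of \<open>E\<close> and \<open>A\<close>
    of greatest degree plays the gcd and becomes both \<open>A1\<close> and the common part of
    \<open>E\<close>. Its cofactors are coprime, which forces the cofactor of \<open>E\<close> to
    divide \<open>B\<close>.\<close>
  define P where "P = (\<lambda>G. lead_coeff G = 1 \<and> G dvd E \<and> G dvd A)"
  have P1: "P 1" by (simp add: P_def)
  have "E \<noteq> 0" using monic(3) by auto
  then have bound: "\<forall>G. P G \<longrightarrow> degree G \<le> degree E"
    by (auto simp: P_def dvd_imp_degree_le)
  obtain G where G: "P G" "\<And>H. P H \<Longrightarrow> degree H \<le> degree G"
    using ex_has_greatest_nat_lemma[of P 1 degree "degree E"]
      Greatest_le_nat by (metis P1 bound ex_has_greatest_nat le_imp_less_Suc)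
  then obtain E2 A2 where E: "E = G * E2" and A: "A = G * A2" by (auto simp: P_def dvd_def)
  have G1: "lead_coeff G = 1" and E2: "lead_coeff E2 = 1" and A2: "lead_coeff A2 = 1"
    using G(1) monic E A by (auto simp: P_def lead_coeff_mult)
  have "coprime A2 E2"
  proof (rule coprimeI)
    fix H assume H: "H dvd A2" "H dvd E2"
    have "H \<noteq> 0" using H A2 by auto
    then obtain H' u where H': "lead_coeff H' = 1" "u \<noteq> 0" "H = Polynomial.smult u H'"
      using ex_monic_associate by blast
    \<comment> \<open>A common factor of the cofactors could be absorbed into \<open>G\<close>;
      maximality leaves only constants.\<close>
    have "P (G * H')" using H H' G1 by (auto simp: P_def E A lead_coeff_mult smult_dvd_iff)
    then have "degree (G * H') \<le> degree G" by (rule G(2))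
    then have "degree H' = 0" using degree_mult_monic[OF G1 H'(1)] by simp
    then have "H' = 1" using H'(1) by (auto elim!: degree_eq_zeroE)
    then show "is_unit H" using H' by (simp add: is_unit_triv is_unit_smult_iff)
  qed
  moreover have G0: "G \<noteq> 0" using G1 by auto
  have eq2: "E2 * F = A2 * B" using eq G0 by (simp add: E A mult.assoc)
  then have "E2 dvd A2 * B" by (metis dvd_triv_left)
  ultimately have "E2 dvd B" by (rule coprime_dvd_mult_poly)
  then obtain B2 where B: "B = E2 * B2" by (auto simp: dvd_def)
  have "E2 \<noteq> 0" using E2 by auto
  then have "F = A2 * B2" using eq2 B by (simp add: mult.left_commute)
  moreover have "lead_coeff B2 = 1" using monic(2) E2 B by (auto simp: lead_coeff_mult)
  ultimately show ?thesis using E A B G1 E2 A2 by blast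
qed

text \<open>The map on the right is onto for all monic \<open>A\<close> and \<open>B\<close>, which
  yields upper bounds for sums over \<open>factor_pairs (A * B)\<close>; for coprime
  \<open>A\<close> and \<open>B\<close> it is also injective, which yields lower bounds.\<close>

lemma factor_pairs_mult:
  fixes A B :: "'a::{field,finite} poly"
  assumes "lead_coeff A = 1" "lead_coeff B = 1"
  shows "factor_pairs (A * B) = (\<lambda>((A1, A2), (B1, B2)). (A1 * B1, A2 * B2)) ` (factor_pairs A \<times> factor_pairs B)"
    (is "_ = ?h ` ?S")
proof (intro equalityI subsetI)
  fix p assume p: "p \<in> factor_pairs (A * B)"
  obtain E F where EF: "p = (E, F)" by (cases p)
  have "A * B \<noteq> 0" using assms by auto
  then obtain A1 A2 B1 B2 where "lead_coeff A1 = 1" "lead_coeff A2 = 1" "lead_coeff B1 = 1" "lead_coeff B2 = 1"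
      "A = A1 * A2" "B = B1 * B2" "E = A1 * B1" "F = A2 * B2"
    using factor_pairs_refine[of A B E F] p EF assms by (auto simp: factor_pairs_def)
  then show "p \<in> ?h ` ?S"
    unfolding EF by (intro image_eqI[of _ _ "((A1, A2), (B1, B2))"]) (auto simp: factor_pairs_def)
qed (auto simp: factor_pairs_def lead_coeff_mult algebra_simps)

text \<open>Each factorisation of \<open>A * B\<close> is a product of factorisations of
  \<open>A\<close> and of \<open>B\<close>, and a sum over an image is at most the sum over the
  domain.\<close>

lemma ndiv_mult_le:
  assumes "lead_coeff A = 1" "lead_coeff B = 1"
  shows "ndiv k (A * B) \<le> ndiv k A * ndiv k B"
  using assms
proof (induction k arbitrary: A B)
  case 0
  then show ?case by (auto simp: ndiv_def monic_mult_eq_1_iff)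
next
  case (Suc k)
  let ?h = "\<lambda>((A1, A2), (B1, B2)). (A1 * B1, A2 * B2)"
  let ?S = "factor_pairs A \<times> factor_pairs B"
  have "ndiv (Suc k) (A * B) = (\<Sum>p\<in>?h ` ?S. ndiv k (snd p))"
    using Suc.prems by (simp add: ndiv_Suc factor_pairs_mult case_prod_beta)
  also have "\<dots> \<le> (\<Sum>p\<in>?S. ndiv k (snd (?h p)))"
    using sum_image_le[of ?S "\<lambda>p. ndiv k (snd p)" ?h] by (auto simp: o_def)
  also have "\<dots> \<le> (\<Sum>p\<in>?S. ndiv k (snd (fst p)) * ndiv k (snd (snd p)))"
    by (intro sum_mono) (auto simp: factor_pairs_def intro!: Suc.IH)
  also have "\<dots> = ndiv (Suc k) A * ndiv (Suc k) B"
    by (simp add: ndiv_Suc sum_product sum.cartesian_product case_prod_beta)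
  finally show ?case .
qed

lemma coprime_monic_mult_eq:
  fixes A1 A2 B1 B2 :: "'a::field poly"
  assumes "coprime A1 B2" "coprime A2 B1" "A1 * B1 = A2 * B2" "lead_coeff A1 = 1" "lead_coeff A2 = 1"
  shows "A1 = A2"
proof (rule monic_dvd_antisym)
  have "coprime B2 A1" "coprime B1 A2" using assms by (simp_all add: coprime_commute)
  moreover have "A1 dvd B2 * A2" "A2 dvd B1 * A1" using assms by (metis dvd_triv_left mult.commute)+
  ultimately show "A1 dvd A2" "A2 dvd A1" using coprime_dvd_mult_poly by blast+
qed (use assms in auto)

lemma ndiv_mult_ge:
  assumes "lead_coeff A = 1" "lead_coeff B = 1" "coprime A B"
  shows "ndiv k A * ndiv k B \<le> ndiv k (A * B)"
  using assms
proof (induction k arbitrary: A B)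
  case 0
  then show ?case by (auto simp: ndiv_def monic_mult_eq_1_iff)
next
  case (Suc k)
  let ?h = "\<lambda>((A1, A2), (B1, B2)). (A1 * B1, A2 * B2)"
  let ?S = "factor_pairs A \<times> factor_pairs B"
  have cop: "coprime U V" if "U dvd A" "V dvd B" for U V
    using Suc.prems(3) that by (meson coprime_divisors)
  \<comment> \<open>For coprime \<open>A\<close> and \<open>B\<close> the components can be
    recovered: \<open>A1\<close> divides \<open>A1' * B1'\<close> and is coprime to
    \<open>B1'\<close>, so it divides \<open>A1'\<close>, and conversely.\<close>
  have inj: "inj_on ?h ?S"
  proof (rule inj_onI)
    fix p p' assume pp: "p \<in> ?S" "p' \<in> ?S" "?h p = ?h p'"
    obtain A1 A2 B1 B2 A1' A2' B1' B2' where p: "p = ((A1, A2), (B1, B2))" "p' = ((A1', A2'), (B1', B2'))"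
      by (cases p, cases p') fastforce
    have *: "(A1, A2) \<in> factor_pairs A" "(B1, B2) \<in> factor_pairs B"
      "(A1', A2') \<in> factor_pairs A" "(B1', B2') \<in> factor_pairs B"
      "A1 * B1 = A1' * B1'" "A2 * B2 = A2' * B2'"
      using pp unfolding p by auto
    then have d: "A1 dvd A" "A2 dvd A" "A1' dvd A" "A2' dvd A" "B1 dvd B" "B2 dvd B" "B1' dvd B" "B2' dvd B"
      by (blast dest: factor_pairs_dvd)+
    have "A1 = A1'"
      using * by (intro coprime_monic_mult_eq[of A1 B1' A1' B1] cop d) (auto simp: factor_pairs_def)
    moreover have "A2 = A2'"
      using * by (intro coprime_monic_mult_eq[of A2 B2' A2' B2] cop d) (auto simp: factor_pairs_def)
    moreover have "A1 \<noteq> 0" "A2 \<noteq> 0" using * by (auto simp: factor_pairs_def)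
    ultimately show "p = p'" unfolding p using * by auto
  qed
  have "ndiv (Suc k) A * ndiv (Suc k) B = (\<Sum>p\<in>?S. ndiv k (snd (fst p)) * ndiv k (snd (snd p)))"
    by (simp add: ndiv_Suc sum_product sum.cartesian_product case_prod_beta)
  also have "\<dots> \<le> (\<Sum>p\<in>?S. ndiv k (snd (?h p)))"
    by (intro sum_mono) (auto simp: factor_pairs_def intro!: Suc.IH cop)
  also have "\<dots> = (\<Sum>p\<in>?h ` ?S. ndiv k (snd p))"
    by (subst sum.reindex[OF inj]) (simp add: o_def)
  also have "\<dots> = ndiv (Suc k) (A * B)"
    using Suc.prems by (simp add: ndiv_Suc factor_pairs_mult case_prod_beta)
  finally show ?case .
qed

lemma ndiv_1: "ndiv k 1 = 1"
proof (induction k)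
  case (Suc k)
  have "factor_pairs (1 :: 'a poly) = {(1, 1)}"
    by (auto simp: factor_pairs_def monic_mult_eq_1_iff)
  then show ?case using Suc by (simp add: ndiv_Suc)
qed (simp add: ndiv_def)

text \<open>Induction on \<open>i\<close>: \<open>ndiv (Suc i * j)\<close> is the convolution of
  \<open>ndiv j\<close> and \<open>ndiv (i * j)\<close>, while submultiplicativity splits the factor
  \<open>ndiv j N\<close> over each factor pair.\<close>

lemma ndiv_mult_index_ge:
  assumes "lead_coeff N = 1"
  shows "ndiv i N * ndiv j N \<le> ndiv (i * j) N"
  using assms
proof (induction i arbitrary: N)
  case 0
  show ?case by (auto simp: ndiv_def[of 0] ndiv_1)
next
  case (Suc i)
  have "ndiv (Suc i) N * ndiv j N = (\<Sum>(A, B)\<in>factor_pairs N. ndiv i B * ndiv j N)"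
    by (simp add: ndiv_Suc sum_distrib_right case_prod_beta)
  also have "\<dots> \<le> (\<Sum>(A, B)\<in>factor_pairs N. ndiv j A * ndiv (i * j) B)"
  proof (rule sum_mono, clarify)
    fix A B assume "(A, B) \<in> factor_pairs N"
    then have AB: "lead_coeff A = 1" "lead_coeff B = 1" "N = A * B" by (auto simp: factor_pairs_def)
    have "ndiv i B * ndiv j N \<le> ndiv i B * (ndiv j A * ndiv j B)"
      unfolding AB(3) using AB by (intro mult_left_mono ndiv_mult_le) auto
    also have "\<dots> = ndiv j A * (ndiv i B * ndiv j B)" by simp
    also have "\<dots> \<le> ndiv j A * ndiv (i * j) B" using AB by (intro mult_left_mono Suc.IH) auto
    finally show "ndiv i B * ndiv j N \<le> ndiv j A * ndiv (i * j) B" .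
  qed
  also have "\<dots> = ndiv (Suc i * j) N" using Suc.prems by (simp add: ndiv_add)
  finally show ?case .
qed

section \<open>Squarefree polynomials\<close>

lemma squarefree_dvd_poly:
  "squarefree (A * B :: 'a::field poly) \<Longrightarrow> squarefree A \<and> squarefree B"
  by (meson dvd_trans dvd_triv_left dvd_triv_right squarefree_def)

lemma squarefree_imp_coprime_poly:
  assumes "squarefree (A * B :: 'a::field poly)"
  shows "coprime A B"
proof (rule coprimeI)
  fix G assume "G dvd A" "G dvd B"
  then have "G ^ 2 dvd A * B" by (simp add: power2_eq_square mult_dvd_mono)
  then show "is_unit G" using assms by (auto simp: squarefree_def)
qed

text \<open>The factors in any factorisation of a squarefree \<open>N\<close> are coprime, so
  \<open>ndiv_mult_ge\<close> reverses the estimate in the proof of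
  \<open>ndiv_mult_index_ge\<close>.\<close>

lemma ndiv_mult_index_le:
  assumes "lead_coeff N = 1" "squarefree N"
  shows "ndiv (i * j) N \<le> ndiv i N * ndiv j N"
  using assms
proof (induction i arbitrary: N)
  case 0
  show ?case by (auto simp: ndiv_def[of 0] ndiv_1)
next
  case (Suc i)
  have "ndiv (Suc i * j) N = (\<Sum>(A, B)\<in>factor_pairs N. ndiv j A * ndiv (i * j) B)"
    using Suc.prems by (simp add: ndiv_add)
  also have "\<dots> \<le> (\<Sum>(A, B)\<in>factor_pairs N. ndiv i B * ndiv j N)"
  proof (rule sum_mono, clarify)
    fix A B assume "(A, B) \<in> factor_pairs N"
    then have AB: "lead_coeff A = 1" "lead_coeff B = 1" "N = A * B" by (auto simp: factor_pairs_def)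
    have sf: "squarefree B" "coprime A B"
      using Suc.prems AB squarefree_dvd_poly squarefree_imp_coprime_poly by blast+
    have "ndiv j A * ndiv (i * j) B \<le> ndiv j A * (ndiv i B * ndiv j B)"
      using AB sf by (intro mult_left_mono Suc.IH) auto
    also have "\<dots> = ndiv i B * (ndiv j A * ndiv j B)" by simp
    also have "\<dots> \<le> ndiv i B * ndiv j N"
      unfolding AB(3) using AB sf by (intro mult_left_mono ndiv_mult_ge) auto
    finally show "ndiv j A * ndiv (i * j) B \<le> ndiv i B * ndiv j N" .
  qed
  also have "\<dots> = ndiv (Suc i) N * ndiv j N"
    by (simp add: ndiv_Suc sum_distrib_right case_prod_beta)
  finally show ?case .
qed

text \<open>Take \<open>T\<close> of greatest degree among the monic polynomials whose square
  divides \<open>N\<close>; a nonconstant square dividing the cofactor could be moved into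
  \<open>T\<close>.\<close>

lemma ex_squarefree_decomposition:
  fixes N :: "'a::field poly"
  assumes N: "lead_coeff N = 1"
  shows "\<exists>S T. lead_coeff S = 1 \<and> lead_coeff T = 1 \<and> squarefree S \<and> N = S * T\<^sup>2"
proof -
  define P where "P = (\<lambda>G. lead_coeff G = 1 \<and> G\<^sup>2 dvd N)"
  have P1: "P 1" by (simp add: P_def)
  have "degree G \<le> degree N" if "P G" for G
  proof -
    have "degree (G\<^sup>2) \<le> degree N" using that N by (intro dvd_imp_degree_le) (auto simp: P_def)
    then show ?thesis using that degree_mult_monic[of G G] by (auto simp: P_def power2_eq_square)
  qed
  then obtain G where G: "P G" "\<And>H. P H \<Longrightarrow> degree H \<le> degree G"
    by (metis P1 ex_has_greatest_nat le_imp_less_Suc)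
  then obtain S where S: "N = G\<^sup>2 * S" by (auto simp: P_def dvd_def)
  have G1: "lead_coeff G = 1" using G by (simp add: P_def)
  then have S1: "lead_coeff S = 1" using N S by (auto simp: lead_coeff_mult lead_coeff_power)
  have "squarefree S"
    unfolding squarefree_def
  proof (intro allI impI)
    fix H assume H: "H\<^sup>2 dvd S"
    then have "H \<noteq> 0" using S1 by auto
    then obtain H' u where H': "lead_coeff H' = 1" "u \<noteq> 0" "H = Polynomial.smult u H'"
      using ex_monic_associate by blast
    have "H'\<^sup>2 dvd S" using H H' by (auto simp: power2_eq_square smult_dvd_iff)
    then have "(G * H')\<^sup>2 dvd N" unfolding S power_mult_distrib by (rule mult_dvd_mono[OF dvd_refl])
    then have "P (G * H')" using G1 H' by (simp add: P_def lead_coeff_mult)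
    then have "degree (G * H') \<le> degree G" by (rule G(2))
    then have "degree H' = 0" using degree_mult_monic[OF G1 H'(1)] by simp
    then have "H' = 1" using H'(1) by (auto elim!: degree_eq_zeroE)
    then show "is_unit H" using H' by (simp add: is_unit_triv is_unit_smult_iff)
  qed
  then show ?thesis using S S1 G1 by (intro exI[of _ S] exI[of _ G]) (auto simp: mult.commute)
qed

section \<open>A lower bound for the mean square of the divisor function\<close>

lemma card_ge_2: "2 \<le> CARD('a::{field,finite})"
proof -
  have "card {0, 1 :: 'a} \<le> CARD('a)" by (rule card_mono) auto
  then show ?thesis by simp
qed

lemma pnorm_pos [simp]: "0 < pnorm N"
  by (simp add: pnorm_def)

lemma pnorm_1 [simp]: "pnorm 1 = 1"
  by (simp add: pnorm_def)

lemma card_monics: "card (monics n :: 'a::{field,finite} poly set) = CARD('a) ^ n"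
proof -
  have "inj_on (\<lambda>xs. Poly xs + Polynomial.monom 1 n) {xs :: 'a list. length xs = n}"
  proof (rule inj_onI, clarsimp)
    fix xs ys :: "'a list"
    assume *: "length ys = length xs" "Poly xs = Poly ys"
    show "xs = ys"
    proof (rule nth_equalityI)
      fix i assume "i < length xs"
      then show "xs ! i = ys ! i"
        using * fun_cong[OF coeff_Poly_eq[of xs], of i] fun_cong[OF coeff_Poly_eq[of ys], of i]
        by (simp add: nth_default_nth)
    qed (use * in simp)
  qed
  then show ?thesis
    using card_lists_length_eq[of "UNIV :: 'a set" n] by (simp add: monics_eq card_image)
qed

lemma sum_monics_upto:
  fixes f :: "'a::{field,finite} poly \<Rightarrow> 'b::comm_semiring_1"
  shows "(\<Sum>N\<in>monics_upto n. f N) = (\<Sum>i\<le>n. \<Sum>N\<in>monics i. f N)"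
  unfolding monics_upto_eq
  by (rule sum.UNION_disjoint) (auto simp: finite_monics, auto simp: monics_def)

lemma sum_monics_upto_degree:
  fixes g :: "nat \<Rightarrow> real"
  shows "(\<Sum>N\<in>(monics_upto n :: 'a::{field,finite} poly set). g (degree N)) = (\<Sum>i\<le>n. real CARD('a) ^ i * g i)"
proof -
  have "(\<Sum>N\<in>(monics i :: 'a poly set). g (degree N)) = (\<Sum>N\<in>(monics i :: 'a poly set). g i)" for i
    by (rule sum.cong) (auto simp: monics_def)
  then show ?thesis by (simp add: sum_monics_upto card_monics)
qed

text \<open>Every degree contributes exactly 1: there are \<open>q ^ i\<close> monic polynomials of
  degree \<open>i\<close>, each of weight \<open>q ^ (-i)\<close>.\<close>

lemma sum_inverse_pnorm:
  "(\<Sum>N\<in>(monics_upto n :: 'a::{field,finite} poly set). 1 / pnorm N) = real n + 1"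
  using sum_monics_upto_degree[of "\<lambda>i. 1 / real CARD('a) ^ i" n, where ?'a = 'a]
  by (simp add: pnorm_def)

lemma sum_inverse_pnorm_power2_le:
  "(\<Sum>N\<in>(monics_upto n :: 'a::{field,finite} poly set). 1 / (pnorm N)\<^sup>2) \<le> 2"
proof -
  have "(\<Sum>N\<in>(monics_upto n :: 'a poly set). 1 / (pnorm N)\<^sup>2) = (\<Sum>i\<le>n. (1 / real CARD('a)) ^ i)"
    using sum_monics_upto_degree[of "\<lambda>i. 1 / (real CARD('a) ^ i)\<^sup>2" n, where ?'a = 'a]
    by (simp add: pnorm_def power2_eq_square power_divide)
  also have "\<dots> \<le> (\<Sum>i\<le>n. (1 / 2) ^ i)"
    using card_ge_2[where ?'a = 'a] by (intro sum_mono power_mono divide_left_mono) auto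
  also have "\<dots> = 2 - (1 / 2) ^ n" by (induction n) auto
  finally show ?thesis by (rule order_trans) simp
qed

text \<open>Up to degree \<open>n\<close> the truncation of the factors is no restriction, so the
  left side is a part of the expansion of the power, whose other terms are nonnegative.\<close>

lemma sum_ndiv_le:
  fixes f :: "'a::{field,finite} poly \<Rightarrow> real"
  assumes f: "\<And>A B. lead_coeff A = 1 \<Longrightarrow> lead_coeff B = 1 \<Longrightarrow> f (A * B) = f A * f B" and "f 1 = 1"
    and nonneg: "\<And>N. 0 \<le> f N" and "k \<ge> 1"
  shows "(\<Sum>N\<in>monics_upto n. ndiv k N * f N) \<le> (\<Sum>N\<in>monics_upto n. f N) ^ k"
proof -
  have "(\<Sum>N\<in>monics_upto n. ndiv k N * f N) = (\<Sum>N\<in>monics_upto n. dconv_power (deg_ind n) k N * f N)"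
    by (intro sum.cong) (auto simp: monics_upto_def dconv_power_deg_ind_eq)
  also have "\<dots> \<le> (\<Sum>N\<in>monics_upto (k * n). dconv_power (deg_ind n) k N * f N)"
  proof (rule sum_mono2)
    have "n \<le> k * n" using \<open>k \<ge> 1\<close> by simp
    then show "monics_upto n \<subseteq> monics_upto (k * n)"
      unfolding monics_upto_def using order_trans by blast
  qed (auto intro!: mult_nonneg_nonneg dconv_power_nonneg nonneg simp: deg_ind_def)
  also have "\<dots> = (\<Sum>N\<in>monics_upto n. f N) ^ k"
    using power_sum_monics[of f n k] f \<open>f 1 = 1\<close> by simp
  finally show ?thesis .
qed

text \<open>A product of \<open>k\<close> factors of degree at most \<open>m\<close> has degree at
  most \<open>n\<close>, and the truncated coefficients are bounded by
  \<open>ndiv k\<close>.\<close>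

lemma sum_ndiv_ge:
  fixes f :: "'a::{field,finite} poly \<Rightarrow> real"
  assumes f: "\<And>A B. lead_coeff A = 1 \<Longrightarrow> lead_coeff B = 1 \<Longrightarrow> f (A * B) = f A * f B" and "f 1 = 1"
    and nonneg: "\<And>N. 0 \<le> f N" and "k * m \<le> n"
  shows "(\<Sum>N\<in>monics_upto m. f N) ^ k \<le> (\<Sum>N\<in>monics_upto n. ndiv k N * f N)"
proof -
  have "(\<Sum>N\<in>monics_upto m. f N) ^ k = (\<Sum>N\<in>monics_upto (k * m). dconv_power (deg_ind m) k N * f N)"
    using power_sum_monics[of f m k] f \<open>f 1 = 1\<close> by simp
  also have "\<dots> \<le> (\<Sum>N\<in>monics_upto (k * m). ndiv k N * f N)"
    by (intro sum_mono mult_right_mono dconv_power_deg_ind_le nonneg)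
  also have "\<dots> \<le> (\<Sum>N\<in>monics_upto n. ndiv k N * f N)"
    using \<open>k * m \<le> n\<close> by (intro sum_mono2 finite_monics_upto) (auto simp: monics_upto_def nonneg)
  finally show ?thesis .
qed

text \<open>This yields the exponent \<open>k\<^sup>2\<close> of the final bound. The left side is a
  lower bound for the sum of \<open>ndiv (k\<^sup>2) N / pnorm N\<close>; the constant bounds the
  contribution of the square parts.\<close>

lemma sum_ndiv_power2_ge:
  assumes "k \<ge> 1"
  shows "(real (n div k\<^sup>2) + 1) ^ k\<^sup>2 \<le>
         2 ^ (k\<^sup>2 * k\<^sup>2) * (\<Sum>N\<in>(monics_upto n :: 'a::{field,finite} poly set). (ndiv k N)\<^sup>2 / pnorm N)"
proof -
  define m where "m = k\<^sup>2"
  have m: "m \<ge> 1" using assms by (simp add: m_def)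
  let ?M = "monics_upto n :: 'a poly set"
  let ?Sq = "{N \<in> ?M. squarefree N}"
  let ?h = "\<lambda>(S, T). S * T\<^sup>2 :: 'a poly"
  let ?F = "\<lambda>N. ndiv m N * (1 / pnorm N)"
  have F0: "0 \<le> ?F N" for N :: "'a poly" by (simp add: less_imp_le)
  \<comment> \<open>The decomposition separates the variables. The square part carries the weight
    \<open>1 / (pnorm T)\<^sup>2\<close>, whose sum stays bounded.\<close>
  have le: "?F (S * T\<^sup>2) \<le> ((ndiv k S)\<^sup>2 / pnorm S) * ((ndiv m T)\<^sup>2 / (pnorm T)\<^sup>2)"
    if "S \<in> ?Sq" "T \<in> ?M" for S T :: "'a poly"
  proof -
    have ST: "lead_coeff S = 1" "lead_coeff T = 1" "lead_coeff (T\<^sup>2) = 1" "squarefree S"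
      using that by (auto simp: monics_upto_def lead_coeff_power)
    have "ndiv m (S * T\<^sup>2) \<le> ndiv m S * ndiv m (T\<^sup>2)" by (intro ndiv_mult_le ST)
    also have "\<dots> \<le> (ndiv k S)\<^sup>2 * (ndiv m T)\<^sup>2"
      unfolding power2_eq_square m_def
      by (intro mult_mono ndiv_mult_index_le ndiv_mult_le ST) auto
    finally have "ndiv m (S * T\<^sup>2) \<le> (ndiv k S)\<^sup>2 * (ndiv m T)\<^sup>2" .
    moreover have "pnorm (S * T\<^sup>2) = pnorm S * (pnorm T)\<^sup>2"
      using ST by (simp add: pnorm_mult power2_eq_square monic_mult del: lead_coeff_mult)
    ultimately show ?thesis by (simp add: divide_right_mono less_imp_le)
  qed
  have cover: "?M \<subseteq> ?h ` (?Sq \<times> ?M)"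
  proof
    fix N :: "'a poly" assume N: "N \<in> ?M"
    then obtain S T where ST: "lead_coeff S = 1" "lead_coeff T = 1" "squarefree S" "N = S * T\<^sup>2"
      using ex_squarefree_decomposition[of N] by (auto simp: monics_upto_def)
    have "S dvd N" "T dvd N" "N \<noteq> 0" using N ST by (auto simp: power2_eq_square monics_upto_def)
    then have "degree S \<le> degree N" "degree T \<le> degree N" by (auto intro: dvd_imp_degree_le)
    then show "N \<in> ?h ` (?Sq \<times> ?M)"
      using N ST by (intro image_eqI[of _ _ "(S, T)"]) (auto simp: monics_upto_def)
  qed
  have "(real (n div m) + 1) ^ m = (\<Sum>N\<in>(monics_upto (n div m) :: 'a poly set). 1 / pnorm N) ^ m"
    by (simp add: sum_inverse_pnorm)
  also have "\<dots> \<le> (\<Sum>N\<in>?M. ?F N)"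
    by (rule sum_ndiv_ge) (auto simp: pnorm_mult less_imp_le)
  also have "\<dots> \<le> (\<Sum>N\<in>?h ` (?Sq \<times> ?M). ?F N)"
    by (intro sum_mono2 cover F0) auto
  also have "\<dots> \<le> (\<Sum>p\<in>?Sq \<times> ?M. ?F (?h p))"
    using sum_image_le[of "?Sq \<times> ?M" ?F ?h] F0 by (simp add: o_def)
  also have "\<dots> \<le> (\<Sum>p\<in>?Sq \<times> ?M. ((ndiv k (fst p))\<^sup>2 / pnorm (fst p)) * ((ndiv m (snd p))\<^sup>2 / (pnorm (snd p))\<^sup>2))"
    using le by (intro sum_mono) auto
  also have "\<dots> = (\<Sum>S\<in>?Sq. (ndiv k S)\<^sup>2 / pnorm S) * (\<Sum>T\<in>?M. (ndiv m T)\<^sup>2 / (pnorm T)\<^sup>2)"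
    by (simp add: sum_product sum.cartesian_product case_prod_beta)
  also have "\<dots> \<le> (\<Sum>S\<in>?M. (ndiv k S)\<^sup>2 / pnorm S) * 2 ^ (m * m)"
  proof (rule mult_mono)
    show "(\<Sum>S\<in>?Sq. (ndiv k S)\<^sup>2 / pnorm S) \<le> (\<Sum>S\<in>?M. (ndiv k S)\<^sup>2 / pnorm S)"
      by (intro sum_mono2) (auto simp: less_imp_le)
    \<comment> \<open>Replacing the square of \<open>ndiv m\<close> by \<open>ndiv (m * m)\<close>
      makes the sum at most a power of a geometric series with value at most 2.\<close>
    have "(\<Sum>T\<in>?M. (ndiv m T)\<^sup>2 / (pnorm T)\<^sup>2) \<le> (\<Sum>T\<in>?M. ndiv (m * m) T * (1 / (pnorm T)\<^sup>2))"
    proof (rule sum_mono)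
      fix T :: "'a poly" assume "T \<in> ?M"
      then have "(ndiv m T)\<^sup>2 \<le> ndiv (m * m) T"
        unfolding power2_eq_square by (intro ndiv_mult_index_ge) (simp add: monics_upto_def)
      then show "(ndiv m T)\<^sup>2 / (pnorm T)\<^sup>2 \<le> ndiv (m * m) T * (1 / (pnorm T)\<^sup>2)"
        by (simp add: divide_right_mono)
    qed
    also have "\<dots> \<le> (\<Sum>T\<in>?M. 1 / (pnorm T)\<^sup>2) ^ (m * m)"
      using m by (intro sum_ndiv_le) (auto simp: pnorm_mult power_mult_distrib)
    also have "\<dots> \<le> 2 ^ (m * m)"
      by (intro power_mono sum_inverse_pnorm_power2_le sum_nonneg) auto
    finally show "(\<Sum>T\<in>?M. (ndiv m T)\<^sup>2 / (pnorm T)\<^sup>2) \<le> 2 ^ (m * m)" .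
  qed (auto intro!: sum_nonneg simp: less_imp_le)
  finally show ?thesis by (simp add: m_def mult.commute)
qed

section \<open>The unit group modulo an irreducible polynomial\<close>

text \<open>The residue classes are represented by their remainders. The ring gives access to the
  cyclicity of the multiplicative group of a finite field.\<close>

definition residue_poly_ring :: "'a::{field,finite} poly \<Rightarrow> 'a poly ring" where
  "residue_poly_ring Q = \<lparr>carrier = range (\<lambda>A. A mod Q), monoid.mult = \<lambda>A B. A * B mod Q, one = 1 mod Q,
     zero = 0, add = \<lambda>A B. (A + B) mod Q\<rparr>"

lemma irreducible_imp_coprime_poly:
  fixes Q A :: "'a::field poly"
  assumes "irreducible Q" "\<not> Q dvd A"
  shows "coprime A Q"
proof (rule coprimeI)
  fix D assume D: "D dvd A" "D dvd Q"
  then obtain E where E: "Q = D * E" by (auto simp: dvd_def)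
  then have "is_unit D \<or> is_unit E" using assms(1) by (metis irreducibleD)
  moreover have "\<not> is_unit E"
  proof
    assume "is_unit E"
    then have "Q dvd D" using E by (metis dvd_refl mult_unit_dvd_iff)
    then show False using D(1) assms(2) dvd_trans by blast
  qed
  ultimately show "is_unit D" by blast
qed

lemma field_residue_poly_ring:
  assumes Q: "irreducible Q"
  shows "field (residue_poly_ring Q)"
proof -
  let ?R = "residue_poly_ring Q"
  have cr: "x \<in> carrier ?R \<longleftrightarrow> x mod Q = x" for x
    by (auto simp: residue_poly_ring_def) (metis rangeI)
  have nz: "1 mod Q \<noteq> 0"
    using Q by (auto simp: irreducible_def mod_eq_0_iff_dvd)
  interpret cring ?R
  proof (rule cringI)
    show "abelian_group ?R"
    proof (rule abelian_groupI)
      fix x assume "x \<in> carrier ?R"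
      then show "\<exists>y\<in>carrier ?R. y \<oplus>\<^bsub>?R\<^esub> x = \<zero>\<^bsub>?R\<^esub>"
        unfolding cr by (intro bexI[of _ "(- x) mod Q"]) (auto simp: cr, simp add: residue_poly_ring_def mod_simps)
    qed (auto simp: cr, auto simp: residue_poly_ring_def mod_simps algebra_simps)
    show "Group.comm_monoid ?R"
      by (rule Group.comm_monoidI) (auto simp: cr, auto simp: residue_poly_ring_def mod_simps algebra_simps)
  qed (auto simp: cr, auto simp: residue_poly_ring_def mod_simps algebra_simps)
  show ?thesis
  proof (rule cring_fieldI, intro equalityI subsetI)
    fix x assume x: "x \<in> Units ?R"
    have "x \<noteq> \<zero>\<^bsub>?R\<^esub>"
      using x nz by (auto simp: Units_def residue_poly_ring_def)
    then show "x \<in> carrier ?R - {\<zero>\<^bsub>?R\<^esub>}" using x by auto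
  next
    fix x assume x: "x \<in> carrier ?R - {\<zero>\<^bsub>?R\<^esub>}"
    then have xQ: "x mod Q = x" "x \<noteq> 0" by (auto simp: cr residue_poly_ring_def)
    then have "\<not> Q dvd x" by (auto simp: dvd_eq_mod_eq_0)
    \<comment> \<open>The Bezout coefficient of \<open>x\<close>, reduced modulo \<open>Q\<close>,
      is its inverse.\<close>
    then obtain U V where UV: "U * x + V * Q = 1"
      using coprime_imp_bezout_poly irreducible_imp_coprime_poly[OF Q] by blast
    have "(U mod Q) * x mod Q = (U * x + V * Q) mod Q" by (simp add: mod_simps)
    then have "(U mod Q) \<otimes>\<^bsub>?R\<^esub> x = \<one>\<^bsub>?R\<^esub>" unfolding UV by (simp add: residue_poly_ring_def)
    moreover have "U mod Q \<in> carrier ?R" by (simp add: cr)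
    moreover have "x \<in> carrier ?R" using x by simp
    ultimately show "x \<in> Units ?R" unfolding Units_def using m_comm[of x "U mod Q"] by auto
  qed
qed

text \<open>Removing the leading term of a monic polynomial of degree \<open>degree Q\<close> leaves
  one of smaller degree, which is its own remainder.\<close>

lemma card_residues_ge:
  fixes Q :: "'a::{field,finite} poly"
  assumes "degree Q > 0"
  shows "CARD('a) ^ degree Q \<le> card (range (\<lambda>A. A mod Q))"
proof -
  let ?d = "degree Q"
  have "inj_on (\<lambda>N :: 'a poly. N - Polynomial.monom 1 ?d) (monics ?d)" by (auto intro: inj_onI)
  moreover have "(\<lambda>N. N - Polynomial.monom 1 ?d) ` monics ?d \<subseteq> range (\<lambda>A. A mod Q)"
  proof (rule image_subsetI)
    fix N :: "'a poly" assume "N \<in> monics ?d"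
    then have "degree (N - Polynomial.monom 1 ?d) < ?d"
      using assms by (intro degree_lessI) (auto simp: monics_def coeff_eq_0 le_less)
    then have "N - Polynomial.monom 1 ?d = (N - Polynomial.monom 1 ?d) mod Q" by (simp add: mod_poly_less)
    then show "N - Polynomial.monom 1 ?d \<in> range (\<lambda>A. A mod Q)" by blast
  qed
  moreover have "Q \<noteq> 0" using assms by auto
  ultimately show ?thesis
    using card_inj_on_le finite_residues card_monics[where ?'a = 'a] by metis
qed

lemma ex_primitive_root_poly:
  fixes Q :: "'a::{field,finite} poly"
  assumes Q: "irreducible Q"
  shows "\<exists>G. \<not> Q dvd G \<and> (\<forall>A. \<not> Q dvd A \<longrightarrow> (\<exists>i. Q dvd A - G ^ i))"
proof -
  let ?R = "residue_poly_ring Q"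
  interpret field ?R by (rule field_residue_poly_ring[OF Q])
  have Q0: "Q \<noteq> 0" using Q by auto
  have "finite (carrier ?R)" using finite_residues[OF Q0] by (simp add: residue_poly_ring_def)
  then obtain G where G: "G \<in> carrier (mult_of ?R)"
    "carrier (mult_of ?R) = {G [^]\<^bsub>?R\<^esub> i | i::nat. i \<in> UNIV}"
    using finite_field_mult_group_has_gen by blast
  have pow: "G [^]\<^bsub>?R\<^esub> i = G ^ i mod Q" for i :: nat
    by (induction i) (auto simp: residue_poly_ring_def mod_simps mult.commute)
  have mem: "A mod Q \<in> carrier (mult_of ?R) \<longleftrightarrow> \<not> Q dvd A" for A
    by (auto simp: residue_poly_ring_def mod_eq_0_iff_dvd)
  have "G mod Q = G" using G(1) by (auto simp: residue_poly_ring_def)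
  then have "\<not> Q dvd G" using G(1) mem[of G] by simp
  moreover have "\<exists>i. Q dvd A - G ^ i" if "\<not> Q dvd A" for A
  proof -
    have "A mod Q \<in> {G [^]\<^bsub>?R\<^esub> i | i::nat. i \<in> UNIV}" using that G(2) mem by blast
    then obtain i :: nat where "A mod Q = G ^ i mod Q" using pow by auto
    then show ?thesis by (auto simp: mod_eq_dvd_iff)
  qed
  ultimately show ?thesis by blast
qed

section \<open>Sums over Dirichlet characters\<close>

text \<open>The multiplicative order of \<open>G\<close> modulo \<open>Q\<close>: the pigeonhole
  principle gives a positive exponent, and \<open>n\<close> is the least one.\<close>

lemma ex_order_poly:
  fixes Q :: "'a::{field,finite} poly"
  assumes "Q \<noteq> 0" "coprime G Q"
  shows "\<exists>n>0. \<forall>i. Q dvd G ^ i - 1 \<longleftrightarrow> n dvd i"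
proof -
  let ?R = "range (\<lambda>A. A mod Q)"
  have copr: "coprime (G ^ i) Q" for i
    by (induction i) (auto simp: coprime_mult_poly_iff assms)
  have sub: "Q dvd G ^ (j - i) - 1 \<longleftrightarrow> Q dvd G ^ j - G ^ i" if "i \<le> j" for i j
  proof -
    have "G ^ j - G ^ i = G ^ i * (G ^ (j - i) - 1)"
      using that by (simp add: right_diff_distrib flip: power_add)
    then show ?thesis using copr coprime_dvd_mult_poly by auto
  qed
  have "\<not> inj_on (\<lambda>i. G ^ i mod Q) {0..card ?R}"
  proof
    assume "inj_on (\<lambda>i. G ^ i mod Q) {0..card ?R}"
    then have "card {0..card ?R} \<le> card ?R"
      by (rule card_inj_on_le) (auto simp: finite_residues assms)
    then show False by simp
  qed
  then obtain i j where ij: "i < j" "G ^ j mod Q = G ^ i mod Q"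
    unfolding inj_on_def by (metis linorder_neqE_nat)
  then have ex: "0 < j - i \<and> Q dvd G ^ (j - i) - 1" by (simp add: sub mod_eq_dvd_iff)
  define n where "n = (LEAST n. 0 < n \<and> Q dvd G ^ n - 1)"
  have n: "0 < n" "Q dvd G ^ n - 1" using LeastI[of "\<lambda>n. 0 < n \<and> Q dvd G ^ n - 1", OF ex] by (auto simp: n_def)
  have "Q dvd G ^ i - 1 \<longleftrightarrow> n dvd i" for i
  proof -
    have "(G ^ n) ^ (i div n) mod Q = 1 ^ (i div n) mod Q"
      using n by (metis mod_eq_dvd_iff power_mod)
    then have "(G ^ n) ^ (i div n) * G ^ (i mod n) mod Q = 1 * G ^ (i mod n) mod Q"
      by (metis mod_mult_cong power_one)
    then have "G ^ i mod Q = G ^ (i mod n) mod Q"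
      by (simp flip: power_mult power_add)
    then have "Q dvd G ^ i - 1 \<longleftrightarrow> Q dvd G ^ (i mod n) - 1"
      by (metis mod_eq_dvd_iff)
    \<comment> \<open>The remainder \<open>i mod n\<close> is below the least positive exponent, so
      it satisfies the congruence only if it is 0.\<close>
    moreover have "\<not> (0 < i mod n \<and> Q dvd G ^ (i mod n) - 1)"
      using n(1) not_less_Least[of "i mod n" "\<lambda>n. 0 < n \<and> Q dvd G ^ n - 1"] by (simp add: n_def)
    ultimately show ?thesis by (cases "i mod n = 0") (auto simp: mod_eq_0_iff_dvd)
  qed
  then show ?thesis using n by blast
qed

text \<open>With a primitive root \<open>G\<close> of order \<open>n\<close>, each
  \<open>n\<close>-th root of unity \<open>z\<close> defines a character sending \<open>A\<close> to
  \<open>z\<close> to the discrete logarithm of \<open>A\<close>. There are \<open>n\<close> of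
  these, and \<open>n\<close> is at least the number of nonzero residues.\<close>

lemma card_dirichlet_characters_ge:
  fixes Q :: "'a::{field,finite} poly"
  assumes Q: "irreducible Q" "degree Q > 0"
  shows "real CARD('a) ^ degree Q - 1 \<le> real (card {\<psi>. dirichlet_character Q \<psi>})"
proof -
  let ?R = "range (\<lambda>A. A mod Q)"
  have Q0: "Q \<noteq> 0" using Q by auto
  obtain G where G: "\<not> Q dvd G" "\<And>A. \<not> Q dvd A \<Longrightarrow> \<exists>i. Q dvd A - G ^ i"
    using ex_primitive_root_poly[OF Q(1)] by blast
  have copr: "coprime A Q \<longleftrightarrow> \<not> Q dvd A" for A
    using irreducible_imp_coprime_poly[OF Q(1)] Q(1)
    by (metis coprime_common_divisor dvd_refl irreducible_not_unit)
  have ndvd_mult: "\<not> Q dvd A * B \<longleftrightarrow> \<not> Q dvd A \<and> \<not> Q dvd B" for A B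
    using coprime_mult_poly_iff[of A B Q] by (simp add: copr)
  obtain n where n: "0 < n" "\<And>i. Q dvd G ^ i - 1 \<longleftrightarrow> n dvd i"
    using ex_order_poly[OF Q0, of G] G(1) copr by blast
  have le: "n dvd j - i" if "i \<le> j" "Q dvd G ^ j - G ^ i" for i j
  proof -
    have "G ^ j - G ^ i = G ^ i * (G ^ (j - i) - 1)"
      using that(1) by (simp add: right_diff_distrib flip: power_add)
    moreover have "\<not> Q dvd G ^ i"
      using G(1) by (induction i) (use Q in \<open>auto simp: ndvd_mult irreducible_def\<close>)
    ultimately show ?thesis using that(2) ndvd_mult n(2) by metis
  qed
  \<comment> \<open>Two logarithms of the same \<open>A\<close> differ by a multiple of the order
    \<open>n\<close>, so the choice made in \<open>lg\<close> does not affect the value.\<close>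
  have root: "z ^ i = z ^ j" if "z ^ n = 1" "Q dvd A - G ^ i" "Q dvd A - G ^ j" for z :: complex and i j A
  proof -
    have *: "z ^ i = z ^ j" if ij: "i \<le> j" "Q dvd G ^ j - G ^ i" for i j
    proof -
      obtain m where m: "j - i = n * m" using le[OF ij] by (auto simp: dvd_def)
      have "z ^ j = z ^ i * z ^ (n * m)" using ij(1) m by (metis le_add_diff_inverse power_add)
      also have "\<dots> = z ^ i" using \<open>z ^ n = 1\<close> by (simp add: power_mult)
      finally show ?thesis by simp
    qed
    have "Q dvd (A - G ^ i) - (A - G ^ j)" "Q dvd (A - G ^ j) - (A - G ^ i)"
      by (rule dvd_diff[OF that(2,3)], rule dvd_diff[OF that(3,2)])
    then have "Q dvd G ^ j - G ^ i" "Q dvd G ^ i - G ^ j" by auto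
    then show ?thesis using *[of i j] *[of j i] by (metis nat_le_linear)
  qed
  define lg where "lg A = (SOME i. Q dvd A - G ^ i)" for A
  have lg: "Q dvd A - G ^ lg A" if "\<not> Q dvd A" for A
    unfolding lg_def using G(2)[OF that] by (rule someI_ex)
  define \<phi> where "\<phi> z A = (if Q dvd A then 0 else z ^ lg A)" for z :: complex and A
  have \<phi>: "\<phi> z A = z ^ i" if "z ^ n = 1" "\<not> Q dvd A" "Q dvd A - G ^ i" for z A i
    using root[OF that(1) lg[OF that(2)] that(3)] that(2) by (simp add: \<phi>_def)
  have char: "dirichlet_character Q (\<phi> z)" if z: "z ^ n = 1" for z
    unfolding dirichlet_character_def
  proof (intro conjI allI)
    fix A B
    have dvd: "Q dvd A + B * Q \<longleftrightarrow> Q dvd A" by (simp add: dvd_add_left_iff)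
    show "\<phi> z (A + B * Q) = \<phi> z A"
    proof (cases "Q dvd A")
      case False
      have "Q dvd (A - G ^ lg A) + B * Q" using lg[OF False] by (intro dvd_add) auto
      then have "Q dvd A + B * Q - G ^ lg A" by (simp add: algebra_simps)
      then show ?thesis using \<phi>[OF z] False dvd lg by metis
    qed (simp add: \<phi>_def dvd)
    show "\<phi> z (A * B) = \<phi> z A * \<phi> z B"
    proof (cases "Q dvd A \<or> Q dvd B")
      case False
      have "Q dvd (A - G ^ lg A) * B + G ^ lg A * (B - G ^ lg B)"
        using lg False by (intro dvd_add) auto
      then have "Q dvd A * B - G ^ (lg A + lg B)" by (simp add: algebra_simps power_add)
      then have "\<phi> z (A * B) = z ^ (lg A + lg B)" using \<phi>[OF z] False ndvd_mult by blast
      then show ?thesis using False by (simp add: \<phi>_def power_add)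
    qed (auto simp: \<phi>_def)
    have "z \<noteq> 0" using z n(1) by (auto simp: power_0_left)
    then show "(\<phi> z A \<noteq> 0) = coprime A Q" by (simp add: \<phi>_def copr)
  qed
  \<comment> \<open>The value at \<open>G\<close> recovers \<open>z\<close>, since 1 is a logarithm
    of \<open>G\<close>.\<close>
  have inj: "inj_on \<phi> {z. z ^ n = 1}"
  proof (rule inj_onI)
    fix z w :: complex assume *: "z \<in> {z. z ^ n = 1}" "w \<in> {z. z ^ n = 1}" "\<phi> z = \<phi> w"
    have "\<phi> v G = v ^ 1" if "v \<in> {z. z ^ n = 1}" for v
      using that by (intro \<phi> G(1)) auto
    then show "z = w" using * by (metis power_one_right)
  qed
  \<comment> \<open>Reducing exponents modulo \<open>n\<close> shows that the first \<open>n\<close>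
    powers of \<open>G\<close> already cover all nonzero residues.\<close>
  have "?R - {0} \<subseteq> (\<lambda>i. G ^ i mod Q) ` {..<n}"
  proof
    fix x assume x: "x \<in> ?R - {0}"
    then obtain A where A: "x = A mod Q" "\<not> Q dvd A" by (auto simp: mod_eq_0_iff_dvd)
    then obtain i where "Q dvd A - G ^ i" using G(2) by blast
    then have "x = G ^ i mod Q" using A by (simp add: mod_eq_dvd_iff)
    moreover have "Q dvd G ^ i - G ^ (i mod n)"
    proof -
      have "G ^ i - G ^ (i mod n) = G ^ (i mod n) * (G ^ (n * (i div n)) - 1)"
        by (simp add: right_diff_distrib flip: power_add)
      then show ?thesis using n(2)[of "n * (i div n)"] by simp
    qed
    ultimately have "x = G ^ (i mod n) mod Q" by (simp add: mod_eq_dvd_iff)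
    then show "x \<in> (\<lambda>i. G ^ i mod Q) ` {..<n}" using n(1) by auto
  qed
  then have "card (?R - {0}) \<le> n" using surj_card_le[of "{..<n}"] by simp
  moreover have "card ?R \<le> card (?R - {0}) + 1"
    using finite_residues[OF Q0]
    by (metis Suc_eq_plus1 card_Diff_singleton_if card_Suc_Diff1 diff_le_self le_SucI order_refl)
  moreover have "n \<le> card {\<psi>. dirichlet_character Q \<psi>}"
  proof -
    have "card {z :: complex. z ^ n = 1} \<le> card {\<psi>. dirichlet_character Q \<psi>}"
      using inj char by (intro card_inj_on_le[of \<phi>] finite_dirichlet_characters Q0) auto
    then show ?thesis using n(1) by (simp add: card_roots_unity_eq)
  qed
  ultimately have "CARD('a) ^ degree Q \<le> card {\<psi>. dirichlet_character Q \<psi>} + 1"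
    using card_residues_ge[OF Q(2)] by simp
  then have "real (CARD('a) ^ degree Q) \<le> real (card {\<psi>. dirichlet_character Q \<psi>} + 1)"
    by (simp only: of_nat_le_iff)
  then show ?thesis by simp
qed

section \<open>Positivity of sums over all characters\<close>

lemma dirichlet_character_mult:
  assumes "dirichlet_character Q \<psi>" "dirichlet_character Q \<phi>"
  shows "dirichlet_character Q (\<lambda>A. \<psi> A * \<phi> A)"
  using assms unfolding dirichlet_character_def by (auto simp: mult_ac)

lemma norm_dirichlet_character:
  assumes "dirichlet_character Q \<psi>" "Q \<noteq> 0" "coprime A Q"
  shows "cmod (\<psi> A) = 1"
proof -
  obtain n where n: "n \<ge> 1" "\<psi> A ^ n = 1"
    using dirichlet_character_root_of_unity[OF assms] by auto
  then have "cmod (\<psi> A) ^ n = 1" by (metis norm_one norm_power)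
  then show ?thesis using n by (intro power_eq_imp_eq_base[of _ n 1]) auto
qed

text \<open>A weak form of orthogonality. If some character \<open>\<eta>\<close> gives a value
  other than 0 and 1, multiplication by it permutes the characters and scales the sum by that value,
  so the sum vanishes. Otherwise every term is 0 or 1.\<close>

lemma sum_dirichlet_characters_nonneg:
  fixes Q :: "'a::{field,finite} poly"
  assumes Q: "Q \<noteq> 0"
  shows "0 \<le> Re (\<Sum>\<psi> | dirichlet_character Q \<psi>. \<psi> A * cnj (\<psi> B))"
proof (cases "\<exists>\<eta>. dirichlet_character Q \<eta> \<and> \<eta> A * cnj (\<eta> B) \<notin> {0, 1}")
  case True
  then obtain \<eta> where \<eta>: "dirichlet_character Q \<eta>" "\<eta> A * cnj (\<eta> B) \<noteq> 1" by blast
  let ?X = "{\<psi>. dirichlet_character Q \<psi>}"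
  let ?m = "\<lambda>\<psi> N. \<eta> N * \<psi> N"
  have inj: "inj_on ?m ?X"
  proof (rule inj_onI, rule ext, clarsimp)
    fix \<psi> \<phi> N
    assume *: "dirichlet_character Q \<psi>" "dirichlet_character Q \<phi>" "?m \<psi> = ?m \<phi>"
    then have "\<eta> N * \<psi> N = \<eta> N * \<phi> N" by metis
    \<comment> \<open>Where \<open>\<eta>\<close> vanishes, so do \<open>\<psi>\<close> and
      \<open>\<phi>\<close>, because all characters modulo \<open>Q\<close> have the same
      zeros.\<close>
    then show "\<psi> N = \<phi> N"
      using * \<eta>(1) unfolding dirichlet_character_def by (metis mult_left_cancel)
  qed
  have img: "?m ` ?X = ?X"
    by (rule endo_inj_surj[OF finite_dirichlet_characters[OF Q] _ inj])
       (use \<eta>(1) in \<open>auto intro: dirichlet_character_mult\<close>)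
  have "(\<Sum>\<psi>\<in>?X. \<psi> A * cnj (\<psi> B)) = (\<Sum>\<psi>\<in>?X. ?m \<psi> A * cnj (?m \<psi> B))"
    using sum.reindex[OF inj, of "\<lambda>\<psi>. \<psi> A * cnj (\<psi> B)"] by (simp only: img o_def)
  also have "\<dots> = \<eta> A * cnj (\<eta> B) * (\<Sum>\<psi>\<in>?X. \<psi> A * cnj (\<psi> B))"
    by (simp add: sum_distrib_left mult_ac)
  finally have "(\<Sum>\<psi>\<in>?X. \<psi> A * cnj (\<psi> B)) = 0" using \<eta>(2) by simp
  then show ?thesis by simp
next
  case False
  then have "0 \<le> Re (\<psi> A * cnj (\<psi> B))" if "dirichlet_character Q \<psi>" for \<psi>
    using that by (metis insertE one_complex.sel(1) order_refl singletonD zero_complex.sel(1) zero_le_one)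
  then show ?thesis by (auto simp only: Re_sum mem_Collect_eq intro!: sum_nonneg)
qed

lemma sum_dirichlet_characters_diag:
  assumes "Q \<noteq> 0" "coprime A Q"
  shows "(\<Sum>\<psi> | dirichlet_character Q \<psi>. \<psi> A * cnj (\<psi> A)) = of_nat (card {\<psi>. dirichlet_character Q \<psi>})"
proof -
  have "\<psi> A * cnj (\<psi> A) = 1" if "dirichlet_character Q \<psi>" for \<psi>
    using norm_dirichlet_character[OF that assms] by (simp add: complex_norm_square[symmetric])
  then show ?thesis by simp
qed

section \<open>Mean values of Dirichlet polynomials over the characters\<close>

definition char_sum :: "('a::{field,finite} poly \<Rightarrow> real) \<Rightarrow> nat \<Rightarrow> ('a poly \<Rightarrow> complex) \<Rightarrow> complex" where
  "char_sum a n \<psi> = (\<Sum>N\<in>monics_upto n. of_real (a N) * \<psi> N)"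

lemma Re_sum_char_sum:
  "Re (\<Sum>\<psi>\<in>X. char_sum a m \<psi> * cnj (char_sum b n \<psi>)) =
     (\<Sum>A\<in>monics_upto m. \<Sum>B\<in>monics_upto n. a A * b B * Re (\<Sum>\<psi>\<in>X. \<psi> A * cnj (\<psi> B)))"
proof -
  have "(\<Sum>\<psi>\<in>X. char_sum a m \<psi> * cnj (char_sum b n \<psi>)) =
        (\<Sum>\<psi>\<in>X. \<Sum>A\<in>monics_upto m. \<Sum>B\<in>monics_upto n. of_real (a A * b B) * (\<psi> A * cnj (\<psi> B)))"
    by (simp add: char_sum_def sum_product mult_ac)
  also have "\<dots> = (\<Sum>A\<in>monics_upto m. \<Sum>B\<in>monics_upto n. \<Sum>\<psi>\<in>X. of_real (a A * b B) * (\<psi> A * cnj (\<psi> B)))"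
    by (subst sum.swap, rule sum.cong[OF refl], subst sum.swap, rule refl)
  also have "\<dots> = (\<Sum>A\<in>monics_upto m. \<Sum>B\<in>monics_upto n. of_real (a A * b B) * (\<Sum>\<psi>\<in>X. \<psi> A * cnj (\<psi> B)))"
    by (simp only: sum_distrib_left)
  finally show ?thesis by (simp only: Re_sum Re_complex_of_real Im_complex_of_real times_complex.sel) simp
qed

lemma Re_sum_char_sum_nonneg:
  assumes "Q \<noteq> 0" "\<And>N. 0 \<le> a N" "\<And>N. 0 \<le> b N"
  shows "0 \<le> Re (\<Sum>\<psi> | dirichlet_character Q \<psi>. char_sum a m \<psi> * cnj (char_sum b n \<psi>))"
  unfolding Re_sum_char_sum
  by (intro sum_nonneg mult_nonneg_nonneg sum_dirichlet_characters_nonneg assms)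

text \<open>All terms of the expanded double sum are nonnegative, so keeping the diagonal gives a
  lower bound. A monic \<open>A\<close> of degree below \<open>degree Q\<close> is coprime to
  \<open>Q\<close>, hence its diagonal sum is the number of characters.\<close>

lemma sum_char_sum_norm_ge:
  fixes Q :: "'a::{field,finite} poly"
  assumes Q: "irreducible Q" and n: "n < degree Q" and a: "\<And>N. 0 \<le> a N"
  shows "real (card {\<psi>. dirichlet_character Q \<psi>}) * (\<Sum>N\<in>monics_upto n. (a N)\<^sup>2) \<le>
    (\<Sum>\<psi> | dirichlet_character Q \<psi>. (cmod (char_sum a n \<psi>))\<^sup>2)"
proof -
  let ?X = "{\<psi>. dirichlet_character Q \<psi>}"
  let ?S = "\<lambda>A B. Re (\<Sum>\<psi>\<in>?X. \<psi> A * cnj (\<psi> B))"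
  have Q0: "Q \<noteq> 0" using Q by auto
  have S: "?S A A = real (card ?X)" if "A \<in> monics_upto n" for A
  proof -
    have "A \<noteq> 0" "degree A < degree Q" using that n by (auto simp: monics_upto_def)
    then have "\<not> Q dvd A" by (meson dvd_imp_degree_le not_le)
    then show ?thesis
      using irreducible_imp_coprime_poly[OF Q] sum_dirichlet_characters_diag[OF Q0] by simp
  qed
  have "real (card ?X) * (\<Sum>N\<in>monics_upto n. (a N)\<^sup>2) = (\<Sum>A\<in>monics_upto n. a A * a A * ?S A A)"
    unfolding sum_distrib_left
    by (rule sum.cong[OF refl], simp only: S) (simp add: power2_eq_square)
  also have "\<dots> \<le> (\<Sum>A\<in>monics_upto n. \<Sum>B\<in>monics_upto n. a A * a B * ?S A B)"
  proof (rule sum_mono)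
    fix A :: "'a poly" assume A: "A \<in> monics_upto n"
    show "a A * a A * ?S A A \<le> (\<Sum>B\<in>monics_upto n. a A * a B * ?S A B)"
      by (rule member_le_sum[OF A, of "\<lambda>B. a A * a B * ?S A B"])
         (intro mult_nonneg_nonneg a sum_dirichlet_characters_nonneg[OF Q0] finite_monics_upto)+
  qed
  also have "\<dots> = Re (\<Sum>\<psi>\<in>?X. char_sum a n \<psi> * cnj (char_sum a n \<psi>))"
    by (simp only: Re_sum_char_sum)
  also have "\<dots> = (\<Sum>\<psi>\<in>?X. (cmod (char_sum a n \<psi>))\<^sup>2)"
    by (simp add: complex_norm_square[symmetric] Re_sum del: of_real_power)
  finally show ?thesis .
qed

section \<open>Mollified moments\<close>

definition half_weight :: "'a::{field,finite} poly \<Rightarrow> real" where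
  "half_weight N = 1 / sqrt (pnorm N)"

lemma half_weight_nonneg [simp]: "0 \<le> half_weight N"
  by (simp add: half_weight_def less_imp_le)

lemma half_weight_1 [simp]: "half_weight 1 = 1"
  by (simp add: half_weight_def)

lemma half_weight_power2: "(half_weight N)\<^sup>2 = 1 / pnorm N"
  by (simp add: half_weight_def power_divide less_imp_le)

lemma half_weight_mult:
  "lead_coeff A = 1 \<Longrightarrow> lead_coeff B = 1 \<Longrightarrow> half_weight (A * B) = half_weight A * half_weight B"
  by (simp add: half_weight_def pnorm_mult real_sqrt_mult)

lemma half_weight_eq: "half_weight N = (1 / sqrt (real CARD('a))) ^ degree (N :: 'a::{field,finite} poly)"
  by (simp add: half_weight_def pnorm_def real_sqrt_power power_divide)

lemma dirichlet_L_half_eq: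
  fixes Q :: "'a::{field,finite} poly"
  assumes "dirichlet_character Q \<psi>" "\<psi> \<noteq> trivial_character Q" "Q \<noteq> 0" "degree Q > 0"
  shows "dirichlet_L \<psi> (1/2) = char_sum half_weight (degree Q - 1) \<psi>"
proof -
  have "complex_of_nat CARD('a) powr (- (1/2)) = of_real (real CARD('a) powr (- (1/2)))"
    using powr_of_real[of "real CARD('a)" "- (1/2)"] by simp
  also have "real CARD('a) powr (- (1/2)) = 1 / sqrt (real CARD('a))"
    by (simp add: powr_minus powr_half_sqrt inverse_eq_divide)
  finally have pw: "(complex_of_nat CARD('a) powr (- (1/2))) ^ n = of_real ((1 / sqrt (real CARD('a))) ^ n)" for n
    by simp
  have "{..<degree Q} = {..degree Q - 1}" using assms(4) by auto
  then have "dirichlet_L \<psi> (1/2) = (\<Sum>n\<le>degree Q - 1. \<Sum>N\<in>monics n. of_real (half_weight N) * \<psi> N)"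
    unfolding dirichlet_L_eq[OF assms(1-3)] pw sum_distrib_left
    by (auto simp: monics_def half_weight_eq intro!: sum.cong)
  then show ?thesis by (simp add: char_sum_def sum_monics_upto)
qed

lemma char_sum_half_weight_power:
  fixes Q :: "'a::{field,finite} poly"
  assumes "dirichlet_character Q \<psi>"
  shows "char_sum half_weight n \<psi> ^ k = char_sum (\<lambda>N. dconv_power (deg_ind n) k N * half_weight N) (k * n) \<psi>"
proof -
  have "(\<Sum>N\<in>monics_upto n. of_real (half_weight N) * \<psi> N) ^ k =
      (\<Sum>N\<in>monics_upto (k * n). of_real (dconv_power (deg_ind n) k N) * (of_real (half_weight N) * \<psi> N))"
    using assms dirichlet_character_1[OF assms]
    by (intro power_sum_monics) (auto simp: half_weight_mult dirichlet_character_def)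
  then show ?thesis by (simp add: char_sum_def mult.assoc)
qed

text \<open>The trivial bound: degree \<open>i\<close> contributes at most \<open>q ^ (i/2)\<close>.
  It holds for every character and is used for the trivial one.\<close>

lemma norm_char_sum_half_weight_le:
  fixes Q :: "'a::{field,finite} poly"
  assumes "dirichlet_character Q \<psi>" "Q \<noteq> 0"
  shows "cmod (char_sum half_weight n \<psi>) \<le> (real n + 1) * sqrt (real CARD('a)) ^ n"
proof -
  let ?r = "sqrt (real CARD('a))"
  have r: "?r \<ge> 1" using card_ge_2[where ?'a = 'a] by simp
  have "cmod (char_sum half_weight n \<psi>) \<le> (\<Sum>N\<in>monics_upto n. cmod (of_real (half_weight N) * \<psi> N))"
    unfolding char_sum_def by (rule norm_sum)
  also have "\<dots> \<le> (\<Sum>N\<in>(monics_upto n :: 'a poly set). (1 / ?r) ^ degree N)"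
  proof (rule sum_mono)
    fix N :: "'a poly"
    have "half_weight N * cmod (\<psi> N) \<le> half_weight N * 1"
      by (intro mult_left_mono norm_dirichlet_character_le_1[OF assms]) simp
    then show "cmod (of_real (half_weight N) * \<psi> N) \<le> (1 / ?r) ^ degree N"
      unfolding norm_mult by (simp flip: half_weight_eq)
  qed
  also have "\<dots> = (\<Sum>i\<le>n. real CARD('a) ^ i * (1 / ?r) ^ i)"
    by (rule sum_monics_upto_degree)
  also have "\<dots> = (\<Sum>i\<le>n. ?r ^ i)"
    by (simp add: real_div_sqrt flip: power_mult_distrib)
  also have "\<dots> \<le> (\<Sum>i\<le>n. ?r ^ n)"
    using r by (intro sum_mono power_increasing) auto
  finally show ?thesis by (simp add: algebra_simps)
qed

text \<open>The \<open>2 * k\<close>-th power is the squared modulus of a character sum of length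
  \<open>k * n\<close>, to which the diagonal bound applies. Of its coefficients only those of
  degree at most \<open>n\<close> are kept, where the truncated divisor function is
  \<open>ndiv k\<close>.\<close>

lemma mollified_moment_ge:
  fixes Q :: "'a::{field,finite} poly"
  assumes Q: "irreducible Q" and n: "k * n < degree Q" and k: "k \<ge> 1"
  shows "real (card {\<psi>. dirichlet_character Q \<psi>}) * (\<Sum>N\<in>(monics_upto n :: 'a poly set). (ndiv k N)\<^sup>2 / pnorm N) \<le>
     (\<Sum>\<psi> | dirichlet_character Q \<psi>. cmod (char_sum half_weight n \<psi>) ^ (2 * k))"
proof -
  let ?X = "{\<psi>. dirichlet_character Q \<psi>}"
  define a where "a N = dconv_power (deg_ind n) k N * half_weight N" for N :: "'a poly"
  have a0: "0 \<le> a N" for N by (simp add: a_def dconv_power_nonneg deg_ind_def)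
  have "n \<le> k * n" using k by simp
  then have sub: "monics_upto n \<subseteq> monics_upto (k * n)" unfolding monics_upto_def using order_trans by blast
  have "(\<Sum>N\<in>(monics_upto n :: 'a poly set). (ndiv k N)\<^sup>2 / pnorm N) = (\<Sum>N\<in>(monics_upto n :: 'a poly set). (a N)\<^sup>2)"
    by (rule sum.cong) (auto simp: monics_upto_def a_def power_mult_distrib half_weight_power2 dconv_power_deg_ind_eq)
  also have "\<dots> \<le> (\<Sum>N\<in>monics_upto (k * n). (a N)\<^sup>2)"
    by (intro sum_mono2 sub) auto
  finally have "real (card ?X) * (\<Sum>N\<in>(monics_upto n :: 'a poly set). (ndiv k N)\<^sup>2 / pnorm N) \<le>
      real (card ?X) * (\<Sum>N\<in>monics_upto (k * n). (a N)\<^sup>2)" by (intro mult_left_mono) auto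
  also have "\<dots> \<le> (\<Sum>\<psi>\<in>?X. (cmod (char_sum a (k * n) \<psi>))\<^sup>2)"
    by (rule sum_char_sum_norm_ge[OF Q n a0])
  also have "\<dots> = (\<Sum>\<psi>\<in>?X. cmod (char_sum half_weight n \<psi>) ^ (2 * k))"
  proof (rule sum.cong, simp)
    fix \<psi> assume "\<psi> \<in> ?X"
    then have "char_sum a (k * n) \<psi> = char_sum half_weight n \<psi> ^ k"
      using char_sum_half_weight_power[of Q \<psi> n k] by (simp add: a_def[abs_def])
    then show "(cmod (char_sum a (k * n) \<psi>))\<^sup>2 = cmod (char_sum half_weight n \<psi>) ^ (2 * k)"
      by (simp add: norm_power mult.commute flip: power_mult)
  qed
  finally show ?thesis .
qed

lemma mollified_moment_le:
  fixes Q :: "'a::{field,finite} poly"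
  assumes Q: "Q \<noteq> 0" and n: "n \<le> m" and k: "k \<ge> 1"
  shows "(\<Sum>\<psi> | dirichlet_character Q \<psi>. cmod (char_sum half_weight n \<psi>) ^ (2 * k)) \<le>
    (\<Sum>\<psi> | dirichlet_character Q \<psi>. cmod (char_sum half_weight m \<psi>) * cmod (char_sum half_weight n \<psi>) ^ (2 * k - 1))"
proof -
  let ?X = "{\<psi>. dirichlet_character Q \<psi>}"
  let ?P = "\<lambda>\<psi> :: 'a poly \<Rightarrow> complex. char_sum half_weight m \<psi>"
  let ?A = "\<lambda>\<psi> :: 'a poly \<Rightarrow> complex. char_sum half_weight n \<psi>"
  \<comment> \<open>The coefficients of \<open>?P - ?A\<close>: nonnegative and supported in degrees
    above \<open>n\<close> and at most \<open>m\<close>. The factor \<open>deg_ind m N\<close>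
    supplies the vanishing that \<open>sum_mult_dconv\<close> asks for.\<close>
  define a where "a N = (1 - deg_ind n N) * deg_ind m N * half_weight N" for N :: "'a poly"
  define b where "b j N = dconv_power (deg_ind n) j N * half_weight N" for j and N :: "'a poly"
  have a0: "0 \<le> a N" for N by (simp add: a_def deg_ind_def)
  have b0: "0 \<le> b j N" for j N by (simp add: b_def dconv_power_nonneg deg_ind_def)
  have A: "?A \<psi> ^ j = char_sum (b j) (j * n) \<psi>" if "\<psi> \<in> ?X" for \<psi> j
    using char_sum_half_weight_power[of Q \<psi> n j] that by (simp add: b_def[abs_def])
  have P: "?P \<psi> - ?A \<psi> = char_sum a m \<psi>" for \<psi>
  proof -
    have "?A \<psi> = (\<Sum>N\<in>monics_upto m. of_real (deg_ind n N * half_weight N) * \<psi> N)"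
      unfolding char_sum_def
      using n by (intro sum.mono_neutral_cong_left finite_monics_upto) (auto simp: monics_upto_def deg_ind_def)
    then have "?P \<psi> - ?A \<psi> = (\<Sum>N\<in>monics_upto m. of_real (half_weight N) * \<psi> N - of_real (deg_ind n N * half_weight N) * \<psi> N)"
      by (simp add: char_sum_def sum_subtractf)
    also have "\<dots> = char_sum a m \<psi>"
      unfolding char_sum_def
      by (rule sum.cong) (auto simp: monics_upto_def deg_ind_def a_def algebra_simps)
    finally show ?thesis .
  qed
  have prod: "char_sum a m \<psi> * char_sum (b (k - 1)) ((k - 1) * n) \<psi> =
      char_sum (dconv a (b (k - 1))) (m + (k - 1) * n) \<psi>" if "\<psi> \<in> ?X" for \<psi>
    unfolding char_sum_def
    using that by (intro sum_mult_dconv) (auto simp: dirichlet_character_def a_def b_def deg_ind_def dconv_power_deg_ind_eq_0)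
  have split: "(?P \<psi> - ?A \<psi>) * ?A \<psi> ^ (k - 1) * cnj (?A \<psi> ^ k) =
      ?P \<psi> * ?A \<psi> ^ (k - 1) * cnj (?A \<psi> ^ k) - of_real (cmod (?A \<psi>) ^ (2 * k))" for \<psi>
  proof -
    have "?A \<psi> * ?A \<psi> ^ (k - 1) = ?A \<psi> ^ k" using k by (metis Suc_diff_1 less_le_trans power_Suc zero_less_one)
    then have "(?P \<psi> - ?A \<psi>) * ?A \<psi> ^ (k - 1) * cnj (?A \<psi> ^ k) =
      ?P \<psi> * ?A \<psi> ^ (k - 1) * cnj (?A \<psi> ^ k) - ?A \<psi> ^ k * cnj (?A \<psi> ^ k)"
      by (simp only: left_diff_distrib)
    also have "?A \<psi> ^ k * cnj (?A \<psi> ^ k) = of_real (cmod (?A \<psi>) ^ (2 * k))"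
      by (simp only: complex_norm_square[symmetric] norm_power power_mult[symmetric] mult.commute)
    finally show ?thesis .
  qed
  \<comment> \<open>Both character sums have nonnegative coefficients, so positivity applies to the
    mean of \<open>(?P - ?A) * ?A ^ (k - 1) * cnj (?A ^ k)\<close>; subtracting out
    \<open>?A\<close> leaves the moment on the left of the claim.\<close>
  have "0 \<le> Re (\<Sum>\<psi>\<in>?X. char_sum (dconv a (b (k - 1))) (m + (k - 1) * n) \<psi> * cnj (char_sum (b k) (k * n) \<psi>))"
    by (intro Re_sum_char_sum_nonneg[OF Q] dconv_nonneg a0 b0)
  also have "\<dots> = Re (\<Sum>\<psi>\<in>?X. (?P \<psi> - ?A \<psi>) * ?A \<psi> ^ (k - 1) * cnj (?A \<psi> ^ k))"
    by (rule arg_cong[of _ _ Re], rule sum.cong[OF refl]) (simp only: A P prod)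
  also have "\<dots> = Re (\<Sum>\<psi>\<in>?X. ?P \<psi> * ?A \<psi> ^ (k - 1) * cnj (?A \<psi> ^ k)) - (\<Sum>\<psi>\<in>?X. cmod (?A \<psi>) ^ (2 * k))"
    unfolding split by (simp only: sum_subtractf minus_complex.sel of_real_sum[symmetric] Re_complex_of_real)
  also have "\<dots> \<le> (\<Sum>\<psi>\<in>?X. cmod (?P \<psi>) * cmod (?A \<psi>) ^ (2 * k - 1)) - (\<Sum>\<psi>\<in>?X. cmod (?A \<psi>) ^ (2 * k))"
  proof -
    have "Re (\<Sum>\<psi>\<in>?X. ?P \<psi> * ?A \<psi> ^ (k - 1) * cnj (?A \<psi> ^ k)) \<le> cmod (\<Sum>\<psi>\<in>?X. ?P \<psi> * ?A \<psi> ^ (k - 1) * cnj (?A \<psi> ^ k))"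
      by (rule complex_Re_le_cmod)
    also have "\<dots> \<le> (\<Sum>\<psi>\<in>?X. cmod (?P \<psi> * ?A \<psi> ^ (k - 1) * cnj (?A \<psi> ^ k)))"
      by (rule norm_sum)
    also have "\<dots> = (\<Sum>\<psi>\<in>?X. cmod (?P \<psi>) * cmod (?A \<psi>) ^ (2 * k - 1))"
    proof -
      have "k - 1 + k = 2 * k - 1" using k by simp
      then show ?thesis
        by (simp only: norm_mult norm_power complex_mod_cnj mult.assoc power_add[symmetric])
    qed
    finally show ?thesis by simp
  qed
  finally show ?thesis by simp
qed

text \<open>A Young inequality with crude constants: the first term dominates if
  \<open>4 * x \<le> y\<close>, the second otherwise. The factor 1/4 is small enough for the first
  term to be absorbed later.\<close>

lemma mult_power_le_young:
  fixes x y :: real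
  assumes "0 \<le> x" "0 \<le> y" "k \<ge> 1"
  shows "x * y ^ (2 * k - 1) \<le> y ^ (2 * k) / 4 + 4 ^ (2 * k - 1) * x ^ (2 * k)"
proof -
  have p: "z ^ (2 * k) = z * z ^ (2 * k - 1)" for z :: real
    using assms(3) by (cases k) auto
  show ?thesis
  proof (cases "4 * x \<le> y")
    case True
    then have "x * y ^ (2 * k - 1) \<le> (y / 4) * y ^ (2 * k - 1)"
      using assms by (intro mult_right_mono) auto
    also have "\<dots> = y ^ (2 * k) / 4" by (simp add: p[of y])
    moreover have "0 \<le> 4 ^ (2 * k - 1) * x ^ (2 * k)" using assms by simp
    ultimately show ?thesis by linarith
  next
    case False
    then have "x * y ^ (2 * k - 1) \<le> x * (4 * x) ^ (2 * k - 1)"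
      using assms by (intro mult_left_mono power_mono) auto
    also have "\<dots> = 4 ^ (2 * k - 1) * x ^ (2 * k)" by (simp add: p[of x] power_mult_distrib)
    moreover have "0 \<le> y ^ (2 * k) / 4" using assms by simp
    ultimately show ?thesis by linarith
  qed
qed

lemma eventually_power_le_exponential:
  fixes e :: real
  assumes "e > 1"
  shows "eventually (\<lambda>n. 4 * real n ^ k \<le> e ^ n) at_top"
  using assms by real_asymp

section \<open>Lower bound for the moments\<close>

text \<open>Trivial bounds give a polynomial in the degree times about \<open>|Q|\<close> to the
  power 3/4. The form \<open>2 * _ + 1\<close> says that the term is at most half of
  \<open>|Q| - 1\<close>.\<close>

lemma trivial_term_le:
  fixes Q :: "'a::{field,finite} poly"
  assumes k: "k \<ge> 1" and d: "degree Q \<ge> 2" and n: "4 * k * n \<le> degree Q"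
    and psi: "dirichlet_character Q \<psi>"
    and large: "4 * real (degree Q) ^ (2 * k) \<le> sqrt (sqrt (real CARD('a))) ^ degree Q"
  shows "2 * (cmod (char_sum half_weight (degree Q - 1) \<psi>) * cmod (char_sum half_weight n \<psi>) ^ (2 * k - 1)) + 1
     \<le> real CARD('a) ^ degree Q"
proof -
  let ?d = "degree Q"
  let ?r = "sqrt (real CARD('a))"
  have r: "?r \<ge> 1" using card_ge_2[where ?'a = 'a] by simp
  have Q: "Q \<noteq> 0" using d by auto
  have "n \<le> k * n" using k by simp
  then have "n + 1 \<le> ?d" using n d by linarith
  then have n1: "real n + 1 \<le> real ?d" by linarith
  \<comment> \<open>In powers of \<open>sqrt q\<close>: the long sum contributes at most
    \<open>?d\<close>, and the short ones at most \<open>2 * k * n\<close>, which is at most half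
    the degree.\<close>
  have exps: "?d - 1 + n * (2 * k - 1) \<le> ?d + ?d div 2"
  proof -
    have "n * (2 * k - 1) \<le> 2 * k * n" by (simp add: mult.commute)
    also have "\<dots> \<le> ?d div 2" using n by linarith
    finally show ?thesis by linarith
  qed
  define X where "X = real ?d ^ (2 * k) * ?r ^ (?d + ?d div 2)"
  have "cmod (char_sum half_weight (?d - 1) \<psi>) * cmod (char_sum half_weight n \<psi>) ^ (2 * k - 1) \<le>
      ((real (?d - 1) + 1) * ?r ^ (?d - 1)) * ((real n + 1) * ?r ^ n) ^ (2 * k - 1)"
    by (intro mult_mono power_mono norm_char_sum_half_weight_le[OF psi Q]) auto
  also have "\<dots> = real ?d * (real n + 1) ^ (2 * k - 1) * ?r ^ (?d - 1 + n * (2 * k - 1))"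
    using d by (simp only: power_mult_distrib power_add power_mult[symmetric]) (simp add: of_nat_diff)
  also have "\<dots> \<le> real ?d * real ?d ^ (2 * k - 1) * ?r ^ (?d + ?d div 2)"
    using r n1 exps by (intro mult_mono power_mono power_increasing) auto
  also have "\<dots> = X"
    using k by (cases k) (auto simp: X_def)
  finally have le: "cmod (char_sum half_weight (?d - 1) \<psi>) * cmod (char_sum half_weight n \<psi>) ^ (2 * k - 1) \<le> X" .
  have "1 \<le> real ?d" using d by simp
  \<comment> \<open>With \<open>1 \<le> X\<close>, the bound \<open>4 * X \<le> q ^ ?d\<close> below
    also covers \<open>2 * X + 1\<close>.\<close>
  then have X1: "1 * 1 \<le> X" unfolding X_def using r by (intro mult_mono one_le_power) auto
  \<comment> \<open>Rounding: \<open>?d\<close> is at most twice \<open>?d - ?d div 2\<close>, also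
    for odd \<open>?d\<close>.\<close>
  have "sqrt ?r ^ ?d \<le> sqrt ?r ^ (2 * (?d - ?d div 2))"
    using r by (intro power_increasing) auto
  also have "\<dots> = ?r ^ (?d - ?d div 2)" using r by (simp add: power_mult)
  finally have "4 * real ?d ^ (2 * k) \<le> ?r ^ (?d - ?d div 2)" using large by linarith
  then have "4 * X \<le> ?r ^ (?d - ?d div 2) * ?r ^ (?d + ?d div 2)"
    unfolding X_def mult.assoc[symmetric] by (intro mult_right_mono) auto
  also have "\<dots> = ?r ^ (2 * ?d)" by (simp add: mult_2 flip: power_add)
  also have "\<dots> = real CARD('a) ^ ?d" by (simp add: power_mult)
  finally show ?thesis using le X1 by linarith
qed

lemma moment_ge:
  fixes Q :: "'a::{field,finite} poly"
  assumes k: "k \<ge> 1" and Q: "irreducible Q" "degree Q \<ge> 2"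
    and large: "4 * real (degree Q) ^ (2 * k) \<le> sqrt (sqrt (real CARD('a))) ^ degree Q"
  shows "(real CARD('a) ^ degree Q - 1) *
      (\<Sum>N\<in>(monics_upto (degree Q div (4 * k)) :: 'a poly set). (ndiv k N)\<^sup>2 / pnorm N) \<le>
    4 ^ (2 * k) * (\<Sum>\<psi> | dirichlet_character Q \<psi> \<and> \<psi> \<noteq> trivial_character Q. cmod (dirichlet_L \<psi> (1/2)) ^ (2 * k))"
proof -
  let ?d = "degree Q"
  let ?q = "real CARD('a)"
  \<comment> \<open>This length makes \<open>k * n < ?d\<close>, for the diagonal terms, and
    \<open>2 * k * n \<le> ?d div 2\<close>, for the trivial character.\<close>
  define n where "n = ?d div (4 * k)"
  let ?X = "{\<psi>. dirichlet_character Q \<psi>}"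
  let ?Y = "{\<psi>. dirichlet_character Q \<psi> \<and> \<psi> \<noteq> trivial_character Q}"
  let ?P = "\<lambda>\<psi> :: 'a poly \<Rightarrow> complex. cmod (char_sum half_weight (?d - 1) \<psi>)"
  let ?A = "\<lambda>\<psi> :: 'a poly \<Rightarrow> complex. cmod (char_sum half_weight n \<psi>)"
  define T where "T = (\<Sum>N\<in>(monics_upto n :: 'a poly set). (ndiv k N)\<^sup>2 / pnorm N)"
  define S where "S = (\<Sum>\<psi>\<in>?X. ?A \<psi> ^ (2 * k))"
  define V where "V = (\<Sum>\<psi>\<in>?Y. ?P \<psi> ^ (2 * k))"
  have Q0: "Q \<noteq> 0" using Q by auto
  have fin: "finite ?X" by (rule finite_dirichlet_characters[OF Q0])
  have n: "4 * k * n \<le> ?d" unfolding n_def by (rule times_div_less_eq_dividend)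
  then have kn: "k * n < ?d" using Q(2) by linarith
  have "n \<le> k * n" using k by simp
  then have nd: "n \<le> ?d - 1" using kn by linarith
  have card: "?q ^ ?d - 1 \<le> real (card ?X)"
    using card_dirichlet_characters_ge[OF Q(1)] Q(2) by simp
  \<comment> \<open>The term \<open>N = 1\<close> alone gives 1. Hence \<open>S\<close> is at least
    \<open>q ^ ?d - 1\<close> and can absorb the trivial character.\<close>
  have T1: "1 \<le> T"
  proof -
    have "(\<Sum>N\<in>{1 :: 'a poly}. (ndiv k N)\<^sup>2 / pnorm N) \<le> T"
      unfolding T_def by (intro sum_mono2 finite_monics_upto) (auto simp: monics_upto_def less_imp_le)
    then show ?thesis by (simp add: ndiv_1)
  qed
  have qd: "1 \<le> ?q ^ ?d" using card_ge_2[where ?'a = 'a] by (intro one_le_power) simp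
  have "(?q ^ ?d - 1) * T \<le> real (card ?X) * T"
    using card T1 by (intro mult_right_mono) auto
  also have "\<dots> \<le> S" unfolding T_def S_def by (rule mollified_moment_ge[OF Q(1) kn k])
  finally have ST: "(?q ^ ?d - 1) * T \<le> S" .
  have "?q ^ ?d - 1 \<le> (?q ^ ?d - 1) * T"
    using mult_left_mono[OF T1, of "?q ^ ?d - 1"] qd by simp
  then have qS: "?q ^ ?d - 1 \<le> S" using ST by linarith
  have X: "?X = insert (trivial_character Q) ?Y" using dirichlet_character_trivial by auto
  have "S \<le> (\<Sum>\<psi>\<in>?X. ?P \<psi> * ?A \<psi> ^ (2 * k - 1))"
    unfolding S_def by (rule mollified_moment_le[OF Q0 nd k])
  also have "\<dots> = ?P (trivial_character Q) * ?A (trivial_character Q) ^ (2 * k - 1) +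
      (\<Sum>\<psi>\<in>?Y. ?P \<psi> * ?A \<psi> ^ (2 * k - 1))"
    using fin unfolding X by (subst sum.insert) auto
  \<comment> \<open>Half of \<open>S\<close> pays for the trivial character and a quarter for the
    Young inequality; the remaining quarter accounts for the factor 4 in front of
    \<open>V\<close>.\<close>
  also have "\<dots> \<le> S / 2 + (S / 4 + 4 ^ (2 * k - 1) * V)"
  proof (rule add_mono)
    show "?P (trivial_character Q) * ?A (trivial_character Q) ^ (2 * k - 1) \<le> S / 2"
      using trivial_term_le[OF k Q(2) n dirichlet_character_trivial large] qS by linarith
    have "(\<Sum>\<psi>\<in>?Y. ?P \<psi> * ?A \<psi> ^ (2 * k - 1)) \<le> (\<Sum>\<psi>\<in>?Y. ?A \<psi> ^ (2 * k) / 4 + 4 ^ (2 * k - 1) * ?P \<psi> ^ (2 * k))"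
      by (intro sum_mono mult_power_le_young k) auto
    also have "\<dots> = (\<Sum>\<psi>\<in>?Y. ?A \<psi> ^ (2 * k)) / 4 + 4 ^ (2 * k - 1) * V"
      by (simp add: V_def sum.distrib sum_divide_distrib sum_distrib_left)
    also have "(\<Sum>\<psi>\<in>?Y. ?A \<psi> ^ (2 * k)) \<le> S"
      unfolding S_def by (intro sum_mono2 fin) auto
    finally show "(\<Sum>\<psi>\<in>?Y. ?P \<psi> * ?A \<psi> ^ (2 * k - 1)) \<le> S / 4 + 4 ^ (2 * k - 1) * V" by simp
  qed
  finally have "S \<le> 4 * 4 ^ (2 * k - 1) * V" by simp
  also have "4 * 4 ^ (2 * k - 1) = (4 :: real) ^ (2 * k)" using k by (cases k) auto
  also have "V = (\<Sum>\<psi>\<in>?Y. cmod (dirichlet_L \<psi> (1/2)) ^ (2 * k))"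
    unfolding V_def using Q0 Q(2) by (intro sum.cong refl) (simp add: dirichlet_L_half_eq[of Q])
  finally show ?thesis using ST unfolding T_def n_def by linarith
qed

theorem theorem1p3:
  fixes k :: nat
  assumes "k \<ge> 1"
  shows "\<exists>c::real. c > 0 \<and> (\<exists>d0::nat. \<forall>Q :: 'a::{field,finite} poly.
           irreducible Q \<longrightarrow> degree Q \<ge> d0 \<longrightarrow>
           (\<Sum>\<psi> | dirichlet_character Q \<psi> \<and> \<psi> \<noteq> trivial_character Q.
              cmod (dirichlet_L \<psi> (1/2)) ^ (2 * k))
           \<ge> c * pnorm Q * real (degree Q) ^ (k\<^sup>2))"
proof -
  let ?q = "real CARD('a)"
  define m where "m = k\<^sup>2"
  \<comment> \<open>The factors come from \<open>q ^ d \<le> 2 * (q ^ d - 1)\<close>, from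
    \<open>moment_ge\<close>, from \<open>sum_ndiv_power2_ge\<close>, and from comparing
    \<open>d\<close> with \<open>4 * k * m\<close> times its rounded quotient plus 1.\<close>
  define C :: real where "C = 2 * 4 ^ (2 * k) * 2 ^ (m * m) * real (4 * k * m) ^ m"
  have m: "m \<ge> 1" using assms by (simp add: m_def)
  have q2: "?q \<ge> 2" using card_ge_2[where ?'a = 'a] by simp
  have "sqrt (sqrt ?q) > 1" using q2 by simp
  from eventually_power_le_exponential[OF this, of "2 * k"]
  obtain d1 where d1: "\<And>n. n \<ge> d1 \<Longrightarrow> 4 * real n ^ (2 * k) \<le> sqrt (sqrt ?q) ^ n"
    by (auto simp: eventually_at_top_linorder)
  have C: "C > 0" using assms m by (simp add: C_def)
  show ?thesis
  proof (intro exI[of _ "1 / C"] conjI exI[of _ "max 2 d1"] allI impI)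
    fix Q :: "'a poly" assume Q: "irreducible Q" "max 2 d1 \<le> degree Q"
    let ?d = "degree Q"
    let ?V = "\<Sum>\<psi> | dirichlet_character Q \<psi> \<and> \<psi> \<noteq> trivial_character Q. cmod (dirichlet_L \<psi> (1/2)) ^ (2 * k)"
    define T where "T = (\<Sum>N\<in>(monics_upto (?d div (4 * k)) :: 'a poly set). (ndiv k N)\<^sup>2 / pnorm N)"
    have T0: "0 \<le> T" unfolding T_def by (intro sum_nonneg) (simp add: less_imp_le)
    \<comment> \<open>Adding 1 makes up for rounding down. The iterated quotient by
      \<open>4 * k\<close> and \<open>m\<close> equals the quotient by
      \<open>4 * k * m\<close>.\<close>
    have "?d \<le> (?d div (4 * k * m) + 1) * (4 * k * m)"
      using assms m dividend_less_div_times[of "4 * k * m" ?d] by (simp add: less_imp_le)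
    then have "real ?d \<le> real (?d div (4 * k) div m + 1) * real (4 * k * m)"
      by (metis div_mult2_eq of_nat_le_iff of_nat_mult)
    then have "real ?d ^ m \<le> ((real (?d div (4 * k) div m) + 1) * real (4 * k * m)) ^ m"
      by (intro power_mono) (auto simp: add.commute)
    also have "\<dots> = (real (?d div (4 * k) div m) + 1) ^ m * real (4 * k * m) ^ m"
      by (rule power_mult_distrib)
    also have "\<dots> \<le> (2 ^ (m * m) * T) * real (4 * k * m) ^ m"
      unfolding T_def m_def by (intro mult_right_mono sum_ndiv_power2_ge assms) simp
    finally have dT: "real ?d ^ m \<le> 2 ^ (m * m) * T * real (4 * k * m) ^ m" .
    have "?q \<le> ?q ^ ?d" using power_increasing[of 1 ?d ?q] q2 Q by simp
    with q2 have "2 \<le> ?q ^ ?d" by (rule order_trans)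
    then have "?q ^ ?d \<le> 2 * (?q ^ ?d - 1)" by simp
    then have "?q ^ ?d * T \<le> 2 * ((?q ^ ?d - 1) * T)"
      using mult_right_mono[OF _ T0] by (simp only: mult.assoc[symmetric])
    also have "(?q ^ ?d - 1) * T \<le> 4 ^ (2 * k) * ?V"
      unfolding T_def using Q by (intro moment_ge assms d1) auto
    finally have qT: "?q ^ ?d * T \<le> 2 * (4 ^ (2 * k) * ?V)" by simp
    have "?q ^ ?d * real ?d ^ m \<le> ?q ^ ?d * (2 ^ (m * m) * T * real (4 * k * m) ^ m)"
      using dT by (intro mult_left_mono) auto
    also have "\<dots> = (?q ^ ?d * T) * (2 ^ (m * m) * real (4 * k * m) ^ m)" by simp
    also have "\<dots> \<le> 2 * (4 ^ (2 * k) * ?V) * (2 ^ (m * m) * real (4 * k * m) ^ m)"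
      using qT by (intro mult_right_mono) auto
    also have "\<dots> = C * ?V" by (simp add: C_def)
    finally have "?q ^ ?d * real ?d ^ m / C \<le> ?V" using C by (simp add: pos_divide_le_eq mult.commute)
    then show "1 / C * pnorm Q * real ?d ^ k\<^sup>2 \<le> ?V" by (simp add: pnorm_def m_def)
  qed (use C in simp)
qed

end
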